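(* Let $n\ge 3$ and let $\gamma=(\gamma_0,\dots,\gamma_n)$ and $\lambda=(\lambda_0,\dots,\lambda_n)$ be two sequences of parameters in $\{1,-1\}$. Assume that the algebras $\mathcal A^{\gamma}_{n+1}$ and $\mathcal A^{\lambda}_{n+1}$ are isomorphic. Then the graphs $\Gamma_e(\mathcal A^{\gamma}_{n+1})$ and $\Gamma_e(\mathcal A^{\lambda}_{n+1})$ are also isomorphic.
   Context: Cayley–Dickson algebras: $\mathcal A_0=\mathbb R$ with trivial conjugation and basis element $e^{(0)}_0=1$. For $\gamma_k\in\{1,-1\}$, $\mathcal A_{k+1}=\mathcal A_k\{\gamma_k\}$ consists of pairs $(a,b)$ of elements of $\mathcal A_k$ with componentwise linear operations, product $(a,b)(c,d)=(ac+\gamma_k\bar d b,\ da+b\bar c)$ and conjugation $\overline{(a,b)}=(\bar a,-b)$; $\mathcal A^{\gamma}_{n+1}=\mathcal A_{n+1}\{\gamma_0,\dots,\gamma_n\}$ denotes the algebra obtained from $\mathbb R$ with successive parameters $\gamma_0,\dots,\gamma_n$. The standard basis of $\mathcal A_{k+1}$ is $e^{(k+1)}_j=(e^{(k)}_j,0)$ for $0\le j<2^k$ and $e^{(k+1)}_j=(0,e^{(k)}_{j-2^k})$ for $2^k\le j<2^{k+1}$. $\mathcal E_n$ is the standard basis of $\mathcal A_n$, $e_0$ is the unit, $\mathcal E'_n=\mathcal E_n\setminus\{e_0\}$. Two elements $u,v$ of an algebra are orthogonal if $uv=vu=0$. The graph $\Gamma_e(\mathcal A_{n+1})$: vertices are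 the lines $\mathbb R(a,b)\subset\mathcal A_{n+1}$ spanned by zero divisors $(a,b)$ with $a\in\mathcal E'_n$, $b\in\pm\mathcal E_n$; two distinct lines are adjacent iff their generators are orthogonal. *)

theory Defs
  imports Complex_Main "HOL-Algebra.QuotRing" "HOL-Algebra.Module"
begin

section \<open>Real algebras\<close>

text \<open>
  A (not necessarily associative) real algebra is presented by the record type
  \<open>(real, 'a) module\<close>. Only the record is used: no associativity or
  commutativity is assumed, so none of the locales on it apply.
\<close>

type_synonym 'a real_algebra = "(real, 'a) module"

definition algebra_iso :: "'a real_algebra \<Rightarrow> 'b real_algebra \<Rightarrow> ('a \<Rightarrow> 'b) set" where
  "algebra_iso A B =
     {h. h \<in> ring_iso A B \<and> (\<forall>r. \<forall>x\<in>carrier A. h (r \<odot>\<^bsub>A\<^esub> x) = r \<odot>\<^bsub>B\<^esub> h x)}"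

definition algebras_isomorphic :: "'a real_algebra \<Rightarrow> 'b real_algebra \<Rightarrow> bool" where
  "algebras_isomorphic A B \<longleftrightarrow> algebra_iso A B \<noteq> {}"

definition zero_divisor :: "'a real_algebra \<Rightarrow> 'a \<Rightarrow> bool" where
  "zero_divisor A u \<longleftrightarrow> u \<in> carrier A \<and> u \<noteq> \<zero>\<^bsub>A\<^esub> \<and>
     (\<exists>v\<in>carrier A. v \<noteq> \<zero>\<^bsub>A\<^esub> \<and> (u \<otimes>\<^bsub>A\<^esub> v = \<zero>\<^bsub>A\<^esub> \<or> v \<otimes>\<^bsub>A\<^esub> u = \<zero>\<^bsub>A\<^esub>))"

definition orthogonal_in :: "'a real_algebra \<Rightarrow> 'a \<Rightarrow> 'a \<Rightarrow> bool" where
  "orthogonal_in A u v \<longleftrightarrow> u \<otimes>\<^bsub>A\<^esub> v = \<zero>\<^bsub>A\<^esub> \<and> v \<otimes>\<^bsub>A\<^esub> u = \<zero>\<^bsub>A\<^esub>"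

definition line :: "'a real_algebra \<Rightarrow> 'a \<Rightarrow> 'a set" where
  "line A u = range (\<lambda>r. r \<odot>\<^bsub>A\<^esub> u)"


section \<open>Cayley--Dickson algebras\<close>

text \<open>
  The carrier of the \<open>k\<close>-th algebra consists of the complete binary trees of depth \<open>k\<close>,
  i.e. of \<open>k\<close>-fold iterated pairs of reals. The operations are meaningful only on trees of the
  appropriate depth; the clauses returning \<open>undefined\<close> are never reached there.
\<close>

datatype cd = CDReal real | CDPair cd cd

primrec cd_carrier :: "nat \<Rightarrow> cd set" where
  "cd_carrier 0 = range CDReal"
| "cd_carrier (Suc k) = {CDPair a b | a b. a \<in> cd_carrier k \<and> b \<in> cd_carrier k}"

primrec cd_zero :: "nat \<Rightarrow> cd" where
  "cd_zero 0 = CDReal 0"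
| "cd_zero (Suc k) = CDPair (cd_zero k) (cd_zero k)"

fun cd_add :: "cd \<Rightarrow> cd \<Rightarrow> cd" where
  "cd_add (CDReal x) (CDReal y) = CDReal (x + y)"
| "cd_add (CDPair a b) (CDPair c d) = CDPair (cd_add a c) (cd_add b d)"
| "cd_add _ _ = undefined"

primrec cd_scale :: "real \<Rightarrow> cd \<Rightarrow> cd" where
  "cd_scale r (CDReal x) = CDReal (r * x)"
| "cd_scale r (CDPair a b) = CDPair (cd_scale r a) (cd_scale r b)"

abbreviation cd_neg :: "cd \<Rightarrow> cd" where
  "cd_neg a \<equiv> cd_scale (- 1) a"

primrec cd_conj :: "cd \<Rightarrow> cd" where
  "cd_conj (CDReal x) = CDReal x"
| "cd_conj (CDPair a b) = CDPair (cd_conj a) (cd_neg b)"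

fun cd_mult :: "(nat \<Rightarrow> real) \<Rightarrow> nat \<Rightarrow> cd \<Rightarrow> cd \<Rightarrow> cd" where
  "cd_mult \<gamma> 0 (CDReal x) (CDReal y) = CDReal (x * y)"
| "cd_mult \<gamma> (Suc k) (CDPair a b) (CDPair c d) =
     CDPair (cd_add (cd_mult \<gamma> k a c) (cd_scale (\<gamma> k) (cd_mult \<gamma> k (cd_conj d) b)))
            (cd_add (cd_mult \<gamma> k d a) (cd_mult \<gamma> k b (cd_conj c)))"
| "cd_mult _ _ _ _ = undefined"

primrec cd_basis :: "nat \<Rightarrow> nat \<Rightarrow> cd" where
  "cd_basis 0 j = CDReal 1"
| "cd_basis (Suc k) j =
     (if j < 2 ^ k then CDPair (cd_basis k j) (cd_zero k)
      else CDPair (cd_zero k) (cd_basis k (j - 2 ^ k)))"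

text \<open>\<open>CD \<gamma> k\<close> is the algebra obtained from the reals by the \<open>k\<close> doublings with parameters
  \<open>\<gamma> 0, \<dots>, \<gamma> (k - 1)\<close>; the further values of \<open>\<gamma>\<close> are irrelevant.\<close>

definition CD :: "(nat \<Rightarrow> real) \<Rightarrow> nat \<Rightarrow> cd real_algebra" where
  "CD \<gamma> k = \<lparr>carrier = cd_carrier k, mult = cd_mult \<gamma> k, one = cd_basis k 0,
             zero = cd_zero k, add = cd_add, smult = cd_scale\<rparr>"

definition std_basis :: "nat \<Rightarrow> cd set" where
  "std_basis n = cd_basis n ` {..<2 ^ n}"

definition imag_basis :: "nat \<Rightarrow> cd set" where
  "imag_basis n = std_basis n - {cd_basis n 0}"

definition signed_basis :: "nat \<Rightarrow> cd set" where
  "signed_basis n = std_basis n \<union> cd_neg ` std_basis n"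


section \<open>Graphs\<close>

record 'v graph =
  verts :: "'v set"
  adj :: "'v \<Rightarrow> 'v \<Rightarrow> bool"

definition graphs_isomorphic :: "'v graph \<Rightarrow> 'w graph \<Rightarrow> bool" where
  "graphs_isomorphic G H \<longleftrightarrow>
     (\<exists>f. bij_betw f (verts G) (verts H) \<and>
          (\<forall>x\<in>verts G. \<forall>y\<in>verts G. adj G x y \<longleftrightarrow> adj H (f x) (f y)))"

text \<open>\<open>Gamma_e \<gamma> n\<close> is the graph of the algebra \<open>CD \<gamma> (n + 1)\<close>. Orthogonality is invariant under
  nonzero rescaling, so the choice of generators in the adjacency relation does not matter.\<close>

definition Gamma_e :: "(nat \<Rightarrow> real) \<Rightarrow> nat \<Rightarrow> cd set graph" where
  "Gamma_e \<gamma> n =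
     (let A = CD \<gamma> (n + 1);
          V = {line A (CDPair a b) | a b.
                 a \<in> imag_basis n \<and> b \<in> signed_basis n \<and> zero_divisor A (CDPair a b)}
      in \<lparr>verts = V,
          adj = (\<lambda>L M. L \<in> V \<and> M \<in> V \<and> L \<noteq> M \<and>
                   (\<exists>u\<in>carrier A. \<exists>v\<in>carrier A.
                      L = line A u \<and> M = line A v \<and> orthogonal_in A u v))\<rparr>)"

end

theory Submission
  imports Defs
begin

text \<open>
  Write \<open>A(\<gamma>)\<close> for the algebra with parameters \<open>\<gamma>\<close>. From the octonions on, every derivation of a double
  \<open>B{\<delta>}\<close> is a derivation of \<open>B\<close> acting on both components, so the derivations of \<open>A(\<gamma>)\<close> are the entrywise
  extensions of those of the octonion algebra \<open>O\<close> with parameters \<open>\<gamma>\<^sub>0, \<gamma>\<^sub>1, \<gamma>\<^sub>2\<close>. An isomorphism transports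
  derivations, which has two consequences. First, a derivation \<open>d \<noteq> 0\<close> with \<open>d\<^sup>3 = d\<close> exists exactly if \<open>O\<close> is
  split, so being split is invariant. Secondly, choose \<open>\<gamma>\<^sub>0 = \<gamma>\<^sub>1 = -1\<close> without loss of generality; left
  multiplications by imaginary quaternions on the second component of \<open>O = H{\<gamma>\<^sub>2}\<close> are derivations, their kernel
  is the algebra with parameters \<open>-1, -1, \<gamma>\<^sub>3, \<gamma>\<^sub>4, \<dots>\<close>, and the relations between them force the corresponding
  kernel in the other algebra to be a copy of the algebra with parameters \<open>-1, -1, \<lambda>\<^sub>3, \<lambda>\<^sub>4, \<dots>\<close>. Induction on
  the number of parameters now gives \<open>\<gamma>\<^sub>k = \<lambda>\<^sub>k\<close> for \<open>k \<ge> 3\<close>, since \<open>-1, -1, \<gamma>\<^sub>3\<close> are the parameters of a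
  division algebra only if \<open>\<gamma>\<^sub>3 = -1\<close>. Finally, any two split octonion algebras are isomorphic by a map that
  permutes the standard basis up to signs; extended entrywise to \<open>A(\<gamma>)\<close>, it induces the isomorphism of graphs.
\<close>


section \<open>Iterated pairs of reals\<close>

text \<open>A type of its own for sequences lets them be an instance of \<open>real_vector\<close>,
  so that spans and linear maps are available at every level.\<close>

datatype vec = Vec (cf: "nat \<Rightarrow> real")

lemma vec_eq_iff: "x = y \<longleftrightarrow> (\<forall>n. cf x n = cf y n)"
  by (metis ext vec.expand)

instantiation vec :: real_vector
begin

definition "0 = Vec (\<lambda>n. 0)"
definition "x + y = Vec (\<lambda>n. cf x n + cf y n)"
definition "x - y = Vec (\<lambda>n. cf x n - cf y n)"
definition "- x = Vec (\<lambda>n. - cf x n)"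
definition "r *\<^sub>R x = Vec (\<lambda>n. r * cf x n)"

instance
  by standard (auto simp: vec_eq_iff zero_vec_def plus_vec_def minus_vec_def uminus_vec_def
      scaleR_vec_def algebra_simps)

end

lemma cf_linear [simp]: "cf 0 n = 0" "cf (x + y) n = cf x n + cf y n" "cf (x - y) n = cf x n - cf y n"
    "cf (- x) n = - cf x n" "cf (r *\<^sub>R x) n = r * cf x n"
  by (simp_all add: zero_vec_def plus_vec_def minus_vec_def uminus_vec_def scaleR_vec_def)

text \<open>Sequences of reals are a home for the algebras of all levels at once: \<open>pair\<close> interleaves two
  sequences, and \<open>S k\<close> below consists of the \<open>k\<close>-fold iterated pairs of reals. The real line is embedded
  by \<open>rl\<close> at every level, because \<open>pair (rl r) 0 = rl r\<close>.\<close>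

definition pair :: "vec \<Rightarrow> vec \<Rightarrow> vec" where
  "pair a b = Vec (\<lambda>n. if even n then cf a (n div 2) else cf b (n div 2))"

definition p1 :: "vec \<Rightarrow> vec" where "p1 x = Vec (\<lambda>n. cf x (2 * n))"
definition p2 :: "vec \<Rightarrow> vec" where "p2 x = Vec (\<lambda>n. cf x (2 * n + 1))"
definition rl :: "real \<Rightarrow> vec" where "rl r = Vec (\<lambda>n. if n = 0 then r else 0)"
abbreviation e0 :: vec where "e0 \<equiv> rl 1"

lemma p1_pair [simp]: "p1 (pair a b) = a"
  and p2_pair [simp]: "p2 (pair a b) = b"
  by (auto simp: pair_def p1_def p2_def)

lemma pair_p1_p2 [simp]: "pair (p1 x) (p2 x) = x"
  by (auto simp: pair_def p1_def p2_def vec_eq_iff)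

lemma pair_eq_iff [simp]: "pair a b = pair c d \<longleftrightarrow> a = c \<and> b = d"
  by (metis p1_pair p2_pair)

lemma pair_eq_zero_iff [simp]: "pair a b = 0 \<longleftrightarrow> a = 0 \<and> b = 0"
proof -
  have "pair 0 0 = 0" by (auto simp: pair_def vec_eq_iff)
  then show ?thesis by (metis pair_eq_iff)
qed


lemma pair_0_0 [simp]: "pair 0 0 = 0"
  by simp

lemma pair_add: "pair a b + pair c d = pair (a + c) (b + d)"
  and pair_diff: "pair a b - pair c d = pair (a - c) (b - d)"
  and pair_minus: "- pair a b = pair (- a) (- b)"
  and pair_scaleR: "r *\<^sub>R pair a b = pair (r *\<^sub>R a) (r *\<^sub>R b)"
  by (auto simp: pair_def vec_eq_iff )

lemma p1_linear [simp]: "p1 (x + y) = p1 x + p1 y" "p1 (x - y) = p1 x - p1 y" "p1 (- x) = - p1 x"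
    "p1 (r *\<^sub>R x) = r *\<^sub>R p1 x" "p1 0 = 0"
  and p2_linear [simp]: "p2 (x + y) = p2 x + p2 y" "p2 (x - y) = p2 x - p2 y" "p2 (- x) = - p2 x"
    "p2 (r *\<^sub>R x) = r *\<^sub>R p2 x" "p2 0 = 0"
  by (auto simp: p1_def p2_def vec_eq_iff )

lemma rl_linear: "rl a + rl b = rl (a + b)" "rl a - rl b = rl (a - b)" "- rl a = rl (- a)"
    "r *\<^sub>R rl a = rl (r * a)"
  by (auto simp: rl_def vec_eq_iff )

lemma rl_eq_iff [simp]: "rl a = rl b \<longleftrightarrow> a = b"
  by (auto simp: rl_def vec_eq_iff)

lemma rl_0 [simp]: "rl 0 = 0"
  by (auto simp: rl_def vec_eq_iff)

lemma rl_eq_zero_iff [simp]: "rl a = 0 \<longleftrightarrow> a = 0"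
  by (metis rl_0 rl_eq_iff)

lemma rl_at_0 [simp]: "cf (rl a) 0 = a"
  by (simp add: rl_def)

lemma p1_rl [simp]: "p1 (rl a) = rl a" and p2_rl [simp]: "p2 (rl a) = 0"
  by (auto simp: p1_def p2_def rl_def vec_eq_iff)

lemma pair_rl_0: "pair (rl a) 0 = rl a"
  by (metis p1_rl p2_rl pair_p1_p2)

fun S :: "nat \<Rightarrow> vec set" where
  "S 0 = range rl"
| "S (Suc k) = {x. p1 x \<in> S k \<and> p2 x \<in> S k}"

declare S.simps [simp del]

lemma pair_in_S [simp]: "pair a b \<in> S (Suc k) \<longleftrightarrow> a \<in> S k \<and> b \<in> S k"
  by (simp add: S.simps)

lemma S_SucE:
  assumes "x \<in> S (Suc k)"
  obtains a b where "x = pair a b" "a \<in> S k" "b \<in> S k"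
  using assms that[of "p1 x" "p2 x"] by (simp add: S.simps)


lemma zero_in_S [simp, intro]: "0 \<in> S k"
proof (induction k)
  case 0
  then show ?case by (metis S.simps(1) rangeI rl_0)
qed (simp add: S.simps)

lemma rl_in_S [simp, intro]: "rl a \<in> S k"
proof (induction k)
  case 0
  then show ?case by (metis S.simps(1) rangeI)
qed (simp add: S.simps)

lemma S_closed [simp, intro]:
  shows "x \<in> S k \<Longrightarrow> y \<in> S k \<Longrightarrow> x + y \<in> S k"
    and "x \<in> S k \<Longrightarrow> y \<in> S k \<Longrightarrow> x - y \<in> S k"
    and "x \<in> S k \<Longrightarrow> - x \<in> S k"
    and "x \<in> S k \<Longrightarrow> r *\<^sub>R x \<in> S k"
  by (induction k arbitrary: x y) (auto simp: S.simps rl_linear)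

lemma subspace_S: "subspace (S k)"
  by (simp add: subspace_def)

section \<open>Conjugation, product and norm form on iterated pairs\<close>

primrec cj :: "nat \<Rightarrow> vec \<Rightarrow> vec" where
  "cj 0 x = x"
| "cj (Suc k) x = pair (cj k (p1 x)) (- p2 x)"

text \<open>The base case reads only the coefficient at 0. The product is therefore bilinear on all
  sequences, and the distributive laws carry no membership conditions.\<close>

primrec mul :: "(nat \<Rightarrow> real) \<Rightarrow> nat \<Rightarrow> vec \<Rightarrow> vec \<Rightarrow> vec" where
  "mul \<gamma> 0 x y = rl (cf x 0 * cf y 0)"
| "mul \<gamma> (Suc k) x y =
     pair (mul \<gamma> k (p1 x) (p1 y) + \<gamma> k *\<^sub>R mul \<gamma> k (cj k (p2 y)) (p2 x))
          (mul \<gamma> k (p2 y) (p1 x) + mul \<gamma> k (p2 x) (cj k (p1 y)))"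

text \<open>The symmetric bilinear form of the norm: \<open>ip \<gamma> k x x\<close> is the real
  number given by \<open>x\<close> times its conjugate, see \<open>mul_cj_self\<close>.\<close>

primrec ip :: "(nat \<Rightarrow> real) \<Rightarrow> nat \<Rightarrow> vec \<Rightarrow> vec \<Rightarrow> real" where
  "ip \<gamma> 0 x y = cf x 0 * cf y 0"
| "ip \<gamma> (Suc k) x y = ip \<gamma> k (p1 x) (p1 y) - \<gamma> k * ip \<gamma> k (p2 x) (p2 y)"

declare cj.simps [simp del] mul.simps [simp del] ip.simps [simp del]

lemma cj_linear [simp]: "cj k (x + y) = cj k x + cj k y" "cj k (x - y) = cj k x - cj k y"
    "cj k (- x) = - cj k x" "cj k (r *\<^sub>R x) = r *\<^sub>R cj k x" "cj k 0 = 0"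
  by (induction k arbitrary: x y)
    (simp_all add: cj.simps pair_add pair_diff pair_minus pair_scaleR)

lemma cj_pair [simp]: "cj (Suc k) (pair a b) = pair (cj k a) (- b)"
  by (simp add: cj.simps)

lemma cj_rl [simp]: "cj k (rl a) = rl a"
  by (induction k) (simp_all add: cj.simps pair_rl_0)

lemma cj_cj [simp]: "cj k (cj k x) = x"
  by (induction k arbitrary: x) (simp_all add: cj.simps)

lemma cj_in_S [simp, intro]: "x \<in> S k \<Longrightarrow> cj k x \<in> S k"
  by (induction k arbitrary: x) (auto simp: cj.simps S.simps)

lemma mul_add_left: "mul \<gamma> k (x + y) z = mul \<gamma> k x z + mul \<gamma> k y z"
  and mul_add_right: "mul \<gamma> k z (x + y) = mul \<gamma> k z x + mul \<gamma> k z y"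
  by (induction k arbitrary: x y z)
    (simp_all add: mul.simps pair_add scaleR_add_right rl_linear algebra_simps)

lemma mul_scaleR_left [simp]: "mul \<gamma> k (r *\<^sub>R x) z = r *\<^sub>R mul \<gamma> k x z"
  and mul_scaleR_right [simp]: "mul \<gamma> k z (r *\<^sub>R x) = r *\<^sub>R mul \<gamma> k z x"
  by (induction k arbitrary: x z)
    (simp_all add: mul.simps pair_scaleR scaleR_add_right rl_linear  mult.left_commute)

lemma mul_minus_left [simp]: "mul \<gamma> k (- x) z = - mul \<gamma> k x z"
  and mul_minus_right [simp]: "mul \<gamma> k z (- x) = - mul \<gamma> k z x"
  using mul_scaleR_left[of \<gamma> k "- 1" x z] mul_scaleR_right[of \<gamma> k z "- 1" x] by simp_all

lemma mul_diff_left: "mul \<gamma> k (x - y) z = mul \<gamma> k x z - mul \<gamma> k y z"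
  and mul_diff_right: "mul \<gamma> k z (x - y) = mul \<gamma> k z x - mul \<gamma> k z y"
  by (metis mul_add_left mul_minus_left diff_conv_add_uminus,
      metis mul_add_right mul_minus_right diff_conv_add_uminus)

lemma mul_zero [simp]: "mul \<gamma> k 0 x = 0" "mul \<gamma> k x 0 = 0"
  using mul_scaleR_left[of \<gamma> k 0 0 x] mul_scaleR_right[of \<gamma> k x 0 0] by simp_all

lemmas mul_distrib = mul_add_left mul_add_right mul_diff_left mul_diff_right

lemma mul_pair [simp]: "mul \<gamma> (Suc k) (pair a b) (pair c d) =
     pair (mul \<gamma> k a c + \<gamma> k *\<^sub>R mul \<gamma> k (cj k d) b) (mul \<gamma> k d a + mul \<gamma> k b (cj k c))"
  by (simp add: mul.simps)

lemma mul_in_S [simp, intro]: "x \<in> S k \<Longrightarrow> y \<in> S k \<Longrightarrow> mul \<gamma> k x y \<in> S k"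
  by (induction k arbitrary: x y) (simp_all add: mul.simps S.simps)

lemma mul_one [simp]: assumes "x \<in> S k"
  shows "mul \<gamma> k e0 x = x" "mul \<gamma> k x e0 = x"
  using assms
proof (induction k arbitrary: x)
  case 0
  case 1 then show ?case by (auto simp: mul.simps S.simps)
  case 2 then show ?case by (auto simp: mul.simps S.simps)
next
  case (Suc k)
  case 1 then show ?case using Suc by (auto simp: mul.simps S.simps)
  case 2 then show ?case using Suc by (auto simp: mul.simps S.simps)
qed

lemma mul_rl [simp]: assumes "x \<in> S k"
  shows "mul \<gamma> k (rl r) x = r *\<^sub>R x" "mul \<gamma> k x (rl r) = r *\<^sub>R x"
proof -
  have "rl r = r *\<^sub>R e0" by (simp add: rl_linear)
  then show "mul \<gamma> k (rl r) x = r *\<^sub>R x" "mul \<gamma> k x (rl r) = r *\<^sub>R x"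
    using assms by (metis mul_scaleR_left mul_one(1), metis mul_scaleR_right mul_one(2))
qed

lemma cj_mul: "cj k (mul \<gamma> k x y) = mul \<gamma> k (cj k y) (cj k x)"
  by (induction k arbitrary: x y) (simp_all add: mul.simps cj.simps mult.commute)

text \<open>The trace is real. Writing a conjugate as a real number minus the element turns
  identities with conjugates into identities about commutators and associators.\<close>

lemma add_cj_real: assumes "x \<in> S k" obtains r where "x + cj k x = rl r"
proof -
  have "\<exists>r. x + cj k x = rl r" using assms
  proof (induction k arbitrary: x)
    case 0
    then show ?case by (auto simp: cj.simps S.simps rl_linear)
  next
    case (Suc k)
    then obtain a b where x: "x = pair a b" "a \<in> S k" by (auto elim: S_SucE)
    then obtain r where "a + cj k a = rl r" using Suc by blast
    then show ?case using x by (auto simp: pair_add pair_rl_0)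
  qed
  then show ?thesis using that by blast
qed

lemma ip_linear [simp]: "ip \<gamma> k (x + y) z = ip \<gamma> k x z + ip \<gamma> k y z"
    "ip \<gamma> k z (x + y) = ip \<gamma> k z x + ip \<gamma> k z y"
    "ip \<gamma> k (r *\<^sub>R x) z = r * ip \<gamma> k x z" "ip \<gamma> k z (r *\<^sub>R x) = r * ip \<gamma> k z x"
  by (induction k arbitrary: x y z) (simp_all add: ip.simps  algebra_simps)

lemma ip_minus [simp]: "ip \<gamma> k (- x) z = - ip \<gamma> k x z" "ip \<gamma> k z (- x) = - ip \<gamma> k z x"
  using ip_linear(3)[of \<gamma> k "- 1" x z] ip_linear(4)[of \<gamma> k z "- 1" x] by simp_all

lemma ip_diff [simp]: "ip \<gamma> k (x - y) z = ip \<gamma> k x z - ip \<gamma> k y z"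
    "ip \<gamma> k z (x - y) = ip \<gamma> k z x - ip \<gamma> k z y"
  by (metis ip_linear(1) ip_minus(1) diff_conv_add_uminus,
      metis ip_linear(2) ip_minus(2) diff_conv_add_uminus)

lemma ip_zero [simp]: "ip \<gamma> k 0 z = 0" "ip \<gamma> k z 0 = 0"
  using ip_linear(3)[of \<gamma> k 0 0 z] ip_linear(4)[of \<gamma> k z 0 0] by simp_all

lemma ip_pair [simp]: "ip \<gamma> (Suc k) (pair a b) (pair c d) = ip \<gamma> k a c - \<gamma> k * ip \<gamma> k b d"
  by (simp add: ip.simps)

lemma ip_commute: "ip \<gamma> k x y = ip \<gamma> k y x"
  by (induction k arbitrary: x y) (simp_all add: ip.simps mult.commute)

text \<open>Both orders are proved in one induction, because the second components enter either
  identity through the second one at the level below.\<close>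

lemma mul_cj_add:
  assumes "x \<in> S k" "y \<in> S k"
  shows "mul \<gamma> k x (cj k y) + mul \<gamma> k y (cj k x) = rl (2 * ip \<gamma> k x y)"
    and "mul \<gamma> k (cj k x) y + mul \<gamma> k (cj k y) x = rl (2 * ip \<gamma> k x y)"
  using assms
proof (induction k arbitrary: x y)
  case 0
  case 1 then show ?case by (auto simp: mul.simps cj.simps ip.simps rl_linear)
  case 2 then show ?case by (auto simp: mul.simps cj.simps ip.simps rl_linear)
next
  case (Suc k)
  have *: "mul \<gamma> (Suc k) x (cj (Suc k) y) + mul \<gamma> (Suc k) y (cj (Suc k) x) = rl (2 * ip \<gamma> (Suc k) x y) \<and>
     mul \<gamma> (Suc k) (cj (Suc k) x) y + mul \<gamma> (Suc k) (cj (Suc k) y) x = rl (2 * ip \<gamma> (Suc k) x y)"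
    if xy: "x \<in> S (Suc k)" "y \<in> S (Suc k)" for x y
  proof -
    obtain a b where x: "x = pair a b" "a \<in> S k" "b \<in> S k" using xy by (auto elim: S_SucE)
    obtain c d where y: "y = pair c d" "c \<in> S k" "d \<in> S k" using xy by (auto elim: S_SucE)
    have 1: "mul \<gamma> k a (cj k c) + mul \<gamma> k c (cj k a) = rl (2 * ip \<gamma> k a c)"
      "mul \<gamma> k (cj k a) c + mul \<gamma> k (cj k c) a = rl (2 * ip \<gamma> k a c)"
      using Suc x y by auto
    have 2: "mul \<gamma> k (cj k d) b = rl (2 * ip \<gamma> k b d) - mul \<gamma> k (cj k b) d"
      using Suc(2)[of b d] x y by (auto simp: algebra_simps)
    have e: "rl (2 * ip \<gamma> (Suc k) x y) = pair (rl (2 * ip \<gamma> k a c) - rl (2 * (\<gamma> k * ip \<gamma> k b d))) 0"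
      using x y by (simp add: pair_rl_0 rl_linear algebra_simps)
    show ?thesis unfolding e unfolding x y using 1
      by (simp add: pair_add 2 scaleR_diff_right rl_linear algebra_simps)
  qed
  case 1 then show ?case using * by blast
  case 2 then show ?case using * by blast
qed

lemma mul_cj_self:
  assumes "x \<in> S k"
  shows "mul \<gamma> k x (cj k x) = rl (ip \<gamma> k x x)" "mul \<gamma> k (cj k x) x = rl (ip \<gamma> k x x)"
proof -
  have *: "y + y = rl (2 * r) \<Longrightarrow> y = rl r" for y r
  proof -
    assume "y + y = rl (2 * r)"
    then have "2 *\<^sub>R y = 2 *\<^sub>R rl r" by (simp add: rl_linear scaleR_2)
    then show "y = rl r" by (simp only: scaleR_cancel_left) simp
  qed
  show "mul \<gamma> k x (cj k x) = rl (ip \<gamma> k x x)" "mul \<gamma> k (cj k x) x = rl (ip \<gamma> k x x)"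
    using mul_cj_add[OF assms assms, of \<gamma>] by (auto intro!: *)
qed

text \<open>Multiplication by an element has multiplication by its conjugate as adjoint, on either
  side and at every level, although the norm need not be multiplicative. The step for one side uses
  the other side one level below.\<close>

lemma ip_mul:
  shows "ip \<gamma> k (mul \<gamma> k x y) z = ip \<gamma> k y (mul \<gamma> k (cj k x) z)"
    and "ip \<gamma> k (mul \<gamma> k x y) z = ip \<gamma> k x (mul \<gamma> k z (cj k y))"
proof (induction k arbitrary: x y z)
  case 0
  case 1 then show ?case by (simp add: ip.simps mul.simps cj.simps)
  case 2 then show ?case by (simp add: ip.simps mul.simps cj.simps)
next
  case (Suc k)
  note l = Suc(1) and r = Suc(2)
  have *: "ip \<gamma> (Suc k) (mul \<gamma> (Suc k) (pair a b) (pair c d)) (pair e f)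
      = ip \<gamma> (Suc k) (pair c d) (mul \<gamma> (Suc k) (cj (Suc k) (pair a b)) (pair e f)) \<and>
     ip \<gamma> (Suc k) (mul \<gamma> (Suc k) (pair a b) (pair c d)) (pair e f)
      = ip \<gamma> (Suc k) (pair a b) (mul \<gamma> (Suc k) (pair e f) (cj (Suc k) (pair c d)))" for a b c d e f
  proof -
    have 1: "ip \<gamma> k (mul \<gamma> k a c) e = ip \<gamma> k c (mul \<gamma> k (cj k a) e)" by (rule l)
    have 2: "ip \<gamma> k (mul \<gamma> k (cj k d) b) e = ip \<gamma> k d (mul \<gamma> k b (cj k e))"
      using l[of "cj k d" b e] r[of d e b] by (simp add: ip_commute)
    have 3: "ip \<gamma> k (mul \<gamma> k d a) f = ip \<gamma> k d (mul \<gamma> k f (cj k a))" by (rule r)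
    have 4: "ip \<gamma> k (mul \<gamma> k b (cj k c)) f = ip \<gamma> k c (mul \<gamma> k (cj k f) b)"
      using l[of "cj k f" b c] r[of b "cj k c" f] by (simp add: ip_commute)
    have 5: "ip \<gamma> k (mul \<gamma> k a c) e = ip \<gamma> k a (mul \<gamma> k e (cj k c))" by (rule r)
    have 6: "ip \<gamma> k (mul \<gamma> k (cj k d) b) e = ip \<gamma> k b (mul \<gamma> k d e)" using l[of "cj k d" b e] by simp
    have 7: "ip \<gamma> k (mul \<gamma> k d a) f = ip \<gamma> k a (mul \<gamma> k (cj k d) f)" by (rule l)
    have 8: "ip \<gamma> k (mul \<gamma> k b (cj k c)) f = ip \<gamma> k b (mul \<gamma> k f c)" using r[of b "cj k c" f] by simp
    show ?thesis
    proof
      show "ip \<gamma> (Suc k) (mul \<gamma> (Suc k) (pair a b) (pair c d)) (pair e f)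
        = ip \<gamma> (Suc k) (pair c d) (mul \<gamma> (Suc k) (cj (Suc k) (pair a b)) (pair e f))"
        by (simp add: 1 2 3 4 algebra_simps)
      show "ip \<gamma> (Suc k) (mul \<gamma> (Suc k) (pair a b) (pair c d)) (pair e f)
        = ip \<gamma> (Suc k) (pair a b) (mul \<gamma> (Suc k) (pair e f) (cj (Suc k) (pair c d)))"
        by (simp add: 5 6 7 8 algebra_simps)
    qed
  qed
  case 1 then show ?case using *[of "p1 x" "p2 x" "p1 y" "p2 y" "p1 z" "p2 z"] by simp
  case 2 then show ?case using *[of "p1 x" "p2 x" "p1 y" "p2 y" "p1 z" "p2 z"] by simp
qed

lemma ip_nondegenerate:
  assumes "x \<in> S k" "\<And>y. y \<in> S k \<Longrightarrow> ip \<gamma> k x y = 0" "\<And>i. i < k \<Longrightarrow> \<gamma> i \<noteq> 0"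
  shows "x = 0"
  using assms
proof (induction k arbitrary: x)
  case 0
  then show ?case using "0"(2)[of e0] by (auto simp: ip.simps S.simps)
next
  case (Suc k)
  then obtain a b where x: "x = pair a b" "a \<in> S k" "b \<in> S k" by (auto elim: S_SucE)
  have "a = 0" using Suc.prems(2)[of "pair _ 0"] Suc.prems(3) x by (intro Suc.IH) auto
  moreover have "b = 0"
  proof (rule Suc.IH)
    fix y assume "y \<in> S k"
    then show "ip \<gamma> k b y = 0" using Suc.prems(2)[of "pair 0 y"] Suc.prems(3)[of k] x by auto
  qed (use Suc.prems x in auto)
  ultimately show ?case using x by simp
qed


section \<open>Derivations\<close>

text \<open>\<open>ii k\<close> and \<open>jj k\<close> are the generators of the first and of the
  second doubling, seen in level \<open>k\<close>. The value 0 is a filler for the levels below the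
  one where they are adjoined.\<close>

primrec ii :: "nat \<Rightarrow> vec" where
  "ii 0 = 0"
| "ii (Suc k) = (if k = 0 then pair 0 e0 else pair (ii k) 0)"

primrec jj :: "nat \<Rightarrow> vec" where
  "jj 0 = 0"
| "jj (Suc k) = (if k = 1 then pair 0 e0 else pair (jj k) 0)"

declare ii.simps [simp del] jj.simps [simp del]

lemma ii_in_S [simp, intro]: "ii k \<in> S k"
  and jj_in_S [simp, intro]: "jj k \<in> S k"
  by (induction k) (auto simp: ii.simps jj.simps)

lemma cj_ii [simp]: "cj k (ii k) = - ii k"
  and cj_jj [simp]: "cj k (jj k) = - jj k"
  by (induction k) (auto simp: ii.simps jj.simps pair_minus)

lemma mul_pair_0_one:
  assumes "c \<in> S k" "d \<in> S k"
  shows "mul \<gamma> (Suc k) (pair c d) (pair 0 e0) = pair (\<gamma> k *\<^sub>R d) c"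
  using assms by simp

text \<open>Right multiplication of \<open>pair a b\<close> by \<open>pair (ii k) 0\<close> acts as
  right multiplication by \<open>ii k\<close> on \<open>a\<close> and by its negative on
  \<open>b\<close>. Applied twice, the signs cancel, so the rule survives at levels that are not
  alternative. The same argument serves \<open>jj\<close>.\<close>

lemma mul_ii_ii:
  assumes "k \<ge> 1" "x \<in> S k"
  shows "mul \<gamma> k (mul \<gamma> k x (ii k)) (ii k) = \<gamma> 0 *\<^sub>R x"
  using assms
proof (induction k arbitrary: x rule: nat_induct_at_least)
  case base
  then obtain a b where x: "x = pair a b" "a \<in> S 0" "b \<in> S 0"
    by (metis One_nat_def S_SucE)
  then show ?case by (simp add: ii.simps mul_pair_0_one pair_scaleR)
next
  case (Suc k)
  then obtain a b where x: "x = pair a b" "a \<in> S k" "b \<in> S k" by (auto elim: S_SucE)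
  then show ?case using Suc by (simp add: ii.simps pair_scaleR)
qed

lemma mul_jj_jj:
  assumes "k \<ge> 2" "x \<in> S k"
  shows "mul \<gamma> k (mul \<gamma> k x (jj k)) (jj k) = \<gamma> 1 *\<^sub>R x"
    and "mul \<gamma> k (mul \<gamma> k x (ii k)) (jj k) = - mul \<gamma> k (mul \<gamma> k x (jj k)) (ii k)"
proof -
  have "mul \<gamma> k (mul \<gamma> k x (jj k)) (jj k) = \<gamma> 1 *\<^sub>R x \<and>
      mul \<gamma> k (mul \<gamma> k x (ii k)) (jj k) = - mul \<gamma> k (mul \<gamma> k x (jj k)) (ii k)"
    using assms
  proof (induction k arbitrary: x rule: nat_induct_at_least)
    case base
    then obtain a b where x: "x = pair a b" "a \<in> S 1" "b \<in> S 1"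
      by (metis S_SucE Suc_1)
    have "2 = Suc 1" by simp
    then show ?case using x
      by (simp only:) (simp add: ii.simps(2)[of "Suc 0"] jj.simps(2)[of "Suc 0"] mul_pair_0_one pair_scaleR pair_minus)
  next
    case (Suc k)
    then obtain a b where x: "x = pair a b" "a \<in> S k" "b \<in> S k" by (auto elim: S_SucE)
    then show ?case using Suc by (simp add: ii.simps jj.simps pair_scaleR pair_minus)
  qed
  then show "mul \<gamma> k (mul \<gamma> k x (jj k)) (jj k) = \<gamma> 1 *\<^sub>R x"
    "mul \<gamma> k (mul \<gamma> k x (ii k)) (jj k) = - mul \<gamma> k (mul \<gamma> k x (jj k)) (ii k)" by auto
qed

lemma mul_jj_ii: "k \<ge> 2 \<Longrightarrow> mul \<gamma> k (jj k) (ii k) = - mul \<gamma> k (ii k) (jj k)"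
  using mul_jj_jj(2)[of k e0 \<gamma>] by simp

lemma quaternion_independent:
  assumes "k \<ge> 2" "rl a + b *\<^sub>R ii k + c *\<^sub>R jj k + d *\<^sub>R mul \<gamma> k (ii k) (jj k) = 0"
  shows "a = 0" "b = 0" "c = 0" "d = 0"
proof -
  have "a = 0 \<and> b = 0 \<and> c = 0 \<and> d = 0" using assms
  proof (induction k rule: nat_induct_at_least)
    case base
    then have "pair (pair (rl a) 0) 0 + b *\<^sub>R ii (Suc (Suc 0)) + c *\<^sub>R jj (Suc (Suc 0)) +
        d *\<^sub>R mul \<gamma> (Suc (Suc 0)) (ii (Suc (Suc 0))) (jj (Suc (Suc 0))) = 0"
      by (simp add: pair_rl_0 numeral_2_eq_2)
    then have *: "a = 0 \<and> b = 0 \<and> rl c + pair 0 (rl d) = 0"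
      by (simp add: ii.simps jj.simps pair_scaleR pair_add rl_linear)
    have "rl c = p1 (rl c + pair 0 (rl d))" "rl d = p2 (rl c + pair 0 (rl d))" by simp_all
    with * have "rl c = 0" "rl d = 0" by simp_all
    then show ?case using * by simp
  next
    case (Suc k)
    then have "pair (rl a) 0 + b *\<^sub>R ii (Suc k) + c *\<^sub>R jj (Suc k) +
        d *\<^sub>R mul \<gamma> (Suc k) (ii (Suc k)) (jj (Suc k)) = 0"
      by (simp add: pair_rl_0)
    then show ?case using Suc by (simp add: ii.simps jj.simps pair_scaleR pair_add)
  qed
  then show "a = 0" "b = 0" "c = 0" "d = 0" by auto
qed

lemma real_of_cj_eq:
  assumes "x \<in> S k" "cj k x = x"
  obtains r where "x = rl r"
proof -
  obtain r where "x + cj k x = rl r" using add_cj_real assms(1) by blast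
  then have "2 *\<^sub>R x = 2 *\<^sub>R rl (r / 2)" using assms(2) by (simp add: rl_linear scaleR_2)
  then have "x = rl (r / 2)" by (simp only: scaleR_cancel_left) simp
  then show ?thesis using that by blast
qed

text \<open>Commuting with \<open>pair (ii n) 0\<close> kills the second component, since right
  multiplication by \<open>ii n\<close> is injective. Commuting with \<open>pair 0 e0\<close> makes
  the first component equal to its conjugate.\<close>

lemma center_real:
  assumes "k \<ge> 2" "c \<in> S k" "\<And>a. a \<in> S k \<Longrightarrow> mul \<gamma> k c a = mul \<gamma> k a c" "\<gamma> 0 \<noteq> 0"
  obtains r where "c = rl r"
proof -
  obtain n where n: "k = Suc n" "n \<ge> 1" using assms(1) by (cases k) auto
  then obtain a b where c: "c = pair a b" "a \<in> S n" "b \<in> S n" using assms(2) by (auto elim: S_SucE)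
  have "mul \<gamma> n b (cj n (ii n)) = mul \<gamma> n b (ii n)" using assms(3)[of "pair (ii n) 0"] n c by simp
  then have "2 *\<^sub>R mul \<gamma> n b (ii n) = 0" by (simp add: scaleR_2 eq_neg_iff_add_eq_0 neg_eq_iff_add_eq_0)
  then have "mul \<gamma> n b (ii n) = 0" by simp
  then have "\<gamma> 0 *\<^sub>R b = 0" using mul_ii_ii[of n b \<gamma>] n c by simp
  then have b: "b = 0" using assms(4) by simp
  have "cj n a = a" using assms(3)[of "pair 0 e0"] n c b by simp
  then obtain r where "a = rl r" using real_of_cj_eq c by blast
  then show ?thesis using that b c by (simp add: pair_rl_0)
qed

text \<open>Associativity with \<open>x\<close> in the middle, tested on \<open>ii n\<close> and
  \<open>jj n\<close>, makes right multiplications by these two units commute on \<open>d\<close>.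
  They also anticommute, hence \<open>d = 0\<close>. Testing on \<open>pair 0 e0\<close> then makes
  the conjugate of \<open>c\<close> central.\<close>

lemma nucleus_real:
  assumes "k \<ge> 3" "x \<in> S k" "\<gamma> 0 \<noteq> 0" "\<gamma> 1 \<noteq> 0"
    and assoc: "\<And>a b. a \<in> S k \<Longrightarrow> b \<in> S k \<Longrightarrow> mul \<gamma> k (mul \<gamma> k a x) b = mul \<gamma> k a (mul \<gamma> k x b)"
  obtains r where "x = rl r"
proof -
  obtain n where n: "k = Suc n" "n \<ge> 2" using assms(1) by (cases k) auto
  then obtain c d where x: "x = pair c d" "c \<in> S n" "d \<in> S n" using assms(2) by (auto elim: S_SucE)
  have "mul \<gamma> n (mul \<gamma> n d a) (cj n b) = mul \<gamma> n (mul \<gamma> n d (cj n b)) a"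
    if "a \<in> S n" "b \<in> S n" for a b
    using assoc[of "pair a 0" "pair b 0"] n x that by simp
  from this[of "ii n" "jj n"] have "- mul \<gamma> n (mul \<gamma> n d (ii n)) (jj n) = - mul \<gamma> n (mul \<gamma> n d (jj n)) (ii n)"
    by simp
  then have "mul \<gamma> n (mul \<gamma> n d (jj n)) (ii n) = - mul \<gamma> n (mul \<gamma> n d (jj n)) (ii n)"
    using mul_jj_jj(2)[of n d \<gamma>] n x by simp
  then have "2 *\<^sub>R mul \<gamma> n (mul \<gamma> n d (jj n)) (ii n) = 0" by (simp add: scaleR_2 eq_neg_iff_add_eq_0)
  then have "mul \<gamma> n (mul \<gamma> n d (jj n)) (ii n) = 0" by simp
  then have "\<gamma> 0 *\<^sub>R mul \<gamma> n d (jj n) = 0" using mul_ii_ii[of n "mul \<gamma> n d (jj n)" \<gamma>] n x by simp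
  then have "\<gamma> 1 *\<^sub>R d = 0" using mul_jj_jj(1)[of n d \<gamma>] n x assms(3) by simp
  then have d: "d = 0" using assms(4) by simp
  have "mul \<gamma> n (cj n c) (cj n b) = mul \<gamma> n (cj n b) (cj n c)" if "b \<in> S n" for b
    using assoc[of "pair 0 e0" "pair b 0"] n x d that by (simp add: cj_mul)
  from this[of "cj n _"] have "mul \<gamma> n (cj n c) b = mul \<gamma> n b (cj n c)" if "b \<in> S n" for b
    using that by simp
  then obtain r where "cj n c = rl r" using center_real[of n "cj n c"] n x assms(3) by blast
  then have "c = rl r" by (metis cj_cj cj_rl)
  then show ?thesis using that d x by (simp add: pair_rl_0)
qed

text \<open>This makes the plane spanned by the unit and the last generator invariant under derivations.\<close>

lemma alternating_pair_real:
  assumes "m \<ge> 3" "c \<in> S m" "d \<in> S m" "\<gamma> 0 \<noteq> 0" "\<gamma> 1 \<noteq> 0" "\<gamma> m \<noteq> 0"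
    and alt: "\<And>v. v \<in> S (Suc m) \<Longrightarrow> mul \<gamma> (Suc m) v (mul \<gamma> (Suc m) v (pair c d))
      = mul \<gamma> (Suc m) (mul \<gamma> (Suc m) v v) (pair c d)"
  obtains r s where "c = rl r" "d = rl s"
proof -
  let ?x = "pair c d" and ?M = "mul \<gamma> (Suc m)" and ?m = "mul \<gamma> m"
  \<comment> \<open>The linearisation of \<open>alt\<close>.\<close>
  have pol: "?M v (?M w ?x) + ?M w (?M v ?x) = ?M (?M v w + ?M w v) ?x"
    if "v \<in> S (Suc m)" "w \<in> S (Suc m)" for v w
    using alt[of "v + w"] alt[of v] alt[of w] that by (simp add: mul_distrib algebra_simps)
  \<comment> \<open>The two components of the linearised identity at \<open>pair a 0\<close> and
    \<open>pair 0 b\<close> say that the conjugates of \<open>d\<close> and of \<open>c\<close>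
    associate in the middle position.\<close>
  have "?m a (?m (cj m d) b) = ?m (?m a (cj m d)) b \<and> ?m (?m b (cj m c)) a = ?m b (?m (cj m c) a)"
    if ab: "a \<in> S m" "b \<in> S m" for a b
  proof -
    obtain r where "a + cj m a = rl r" using add_cj_real ab by blast
    then have r: "cj m a = rl r - a" by (simp add: algebra_simps)
    have "?M (pair a 0) (?M (pair 0 b) ?x) + ?M (pair 0 b) (?M (pair a 0) ?x)
      = ?M (?M (pair a 0) (pair 0 b) + ?M (pair 0 b) (pair a 0)) ?x"
      using ab by (intro pol) auto
    then have "\<gamma> m *\<^sub>R ?m a (?m (cj m d) b) = \<gamma> m *\<^sub>R ?m (?m a (cj m d)) b"
      and "?m (?m b (cj m c)) a = ?m b (?m (cj m c) a)"
      using ab assms(2,3) by (auto simp: pair_add cj_mul r mul_distrib algebra_simps)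
    then show ?thesis using assms(6) by simp
  qed
  note nuc = this
  obtain r where "cj m c = rl r"
    using nucleus_real[of m "cj m c" \<gamma>] nuc assms by (metis cj_in_S)
  moreover obtain s where "cj m d = rl s"
    using nucleus_real[of m "cj m d" \<gamma>] nuc assms by (metis cj_in_S)
  ultimately show ?thesis using that by (metis cj_cj cj_rl)
qed

section \<open>Derivations of a double\<close>

definition lin :: "nat \<Rightarrow> nat \<Rightarrow> (vec \<Rightarrow> vec) \<Rightarrow> bool" where
  "lin k l f \<longleftrightarrow> (\<forall>x\<in>S k. f x \<in> S l) \<and> (\<forall>x\<in>S k. \<forall>y\<in>S k. f (x + y) = f x + f y) \<and>
     (\<forall>r. \<forall>x\<in>S k. f (r *\<^sub>R x) = r *\<^sub>R f x)"

lemma linD: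
  assumes "lin k l f"
  shows "x \<in> S k \<Longrightarrow> f x \<in> S l" "x \<in> S k \<Longrightarrow> y \<in> S k \<Longrightarrow> f (x + y) = f x + f y"
    "x \<in> S k \<Longrightarrow> f (r *\<^sub>R x) = r *\<^sub>R f x" "x \<in> S k \<Longrightarrow> f (- x) = - f x" "f 0 = 0"
    "x \<in> S k \<Longrightarrow> y \<in> S k \<Longrightarrow> f (x - y) = f x - f y"
proof -
  show 1: "x \<in> S k \<Longrightarrow> f x \<in> S l" "x \<in> S k \<Longrightarrow> y \<in> S k \<Longrightarrow> f (x + y) = f x + f y"
    "x \<in> S k \<Longrightarrow> f (r *\<^sub>R x) = r *\<^sub>R f x" for x y r using assms by (auto simp: lin_def)
  show m: "x \<in> S k \<Longrightarrow> f (- x) = - f x" for x using 1(3)[of x "- 1"] by simp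
  show "f 0 = 0" using 1(3)[of 0 0] by simp
  show "x \<in> S k \<Longrightarrow> y \<in> S k \<Longrightarrow> f (x - y) = f x - f y"
    using 1(2)[of x "- y"] m[of y] by simp
qed

text \<open>A conjugate is a real number minus the element. The real parts drop out of the
  commutator and the two signs cancel.\<close>

lemma commutator_cj:
  assumes "a \<in> S k" "b \<in> S k"
  shows "mul \<gamma> k (cj k a) (cj k b) - mul \<gamma> k (cj k b) (cj k a) = mul \<gamma> k a b - mul \<gamma> k b a"
proof -
  obtain r where "a + cj k a = rl r" using add_cj_real assms by blast
  then have r: "cj k a = rl r - a" by (simp add: algebra_simps)
  obtain s where "b + cj k b = rl s" using add_cj_real assms by blast
  then have s: "cj k b = rl s - b" by (simp add: algebra_simps)
  show ?thesis using assms by (simp add: r s mul_distrib rl_linear mult.commute algebra_simps)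
qed

text \<open>The equation below is satisfied by the second component of a derivation of the next algebra,
  restricted to the elements with second component zero.\<close>

lemma twisted_derivation_eq_0:
  assumes n: "n \<ge> 2" and \<gamma>: "\<gamma> 0 \<noteq> 0" "\<gamma> 1 \<noteq> 0" "\<gamma> n \<noteq> 0"
    and lin: "lin (Suc n) (Suc n) T"
    and T: "\<And>a c. a \<in> S (Suc n) \<Longrightarrow> c \<in> S (Suc n) \<Longrightarrow>
      T (mul \<gamma> (Suc n) a c) = mul \<gamma> (Suc n) (T a) (cj (Suc n) c) + mul \<gamma> (Suc n) (T c) a"
    and y: "y \<in> S (Suc n)"
  shows "T y = 0"
proof -
  let ?m = "mul \<gamma> n" and ?M = "mul \<gamma> (Suc n)" and ?l = "pair 0 e0"
  note L = linD[OF lin]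
  define P where "P a = p1 (T (pair a 0))" for a
  define Q where "Q a = p2 (T (pair a 0))" for a
  have PQ: "T (pair a 0) = pair (P a) (Q a)" for a by (simp add: P_def Q_def)
  have PQS: "P a \<in> S n" "Q a \<in> S n" if "a \<in> S n" for a
    using L(1)[of "pair a 0"] that unfolding PQ by auto
  obtain x1 x2 where x: "T ?l = pair x1 x2" "x1 \<in> S n" "x2 \<in> S n"
    using L(1)[of ?l] by (auto elim: S_SucE)
  \<comment> \<open>\<open>pair a 0\<close> times \<open>?l\<close> is \<open>pair 0 a\<close>, so
    the twisted rule expresses \<open>T\<close> on the second half through \<open>P\<close>,
    \<open>Q\<close> and the image of \<open>?l\<close>.\<close>
  have T0: "T (pair 0 a) = pair (?m x1 a - \<gamma> n *\<^sub>R Q a) (?m x2 (cj n a) - P a)" if a: "a \<in> S n" for a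
  proof -
    have "pair 0 a = ?M (pair a 0) ?l" using a by simp
    then have "T (pair 0 a) = ?M (pair (P a) (Q a)) (cj (Suc n) ?l) + ?M (pair x1 x2) (pair a 0)"
      using T[of "pair a 0" ?l] a x PQ by auto
    then show ?thesis using a PQS by (simp add: pair_add pair_minus)
  qed
  \<comment> \<open>Multiplying by \<open>?l\<close> once more returns to a multiple of
    \<open>pair a 0\<close>. Comparison with \<open>T (pair a 0)\<close> forces both components of
    \<open>T ?l\<close> to be central.\<close>
  have cent: "?m x1 a = ?m a x1" "?m x2 (cj n a) = ?m (cj n a) x2" if a: "a \<in> S n" for a
  proof -
    have "\<gamma> n *\<^sub>R pair a 0 = ?M (pair 0 a) ?l" using a by (simp add: pair_scaleR)
    then have "\<gamma> n *\<^sub>R T (pair a 0) = ?M (T (pair 0 a)) (cj (Suc n) ?l) + ?M (pair x1 x2) (pair 0 a)"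
      using T[of "pair 0 a" ?l] a x L(3)[of "pair a 0" "\<gamma> n"] by simp
    then show "?m x1 a = ?m a x1" "?m x2 (cj n a) = ?m (cj n a) x2"
      unfolding T0[OF a] PQ using a x PQS[OF a] \<gamma>
      by (auto simp: pair_add pair_minus pair_scaleR scaleR_diff_right algebra_simps)
  qed
  obtain \<alpha> where \<alpha>: "x1 = rl \<alpha>" using center_real[of n x1 \<gamma>] cent(1) n x \<gamma> by blast
  have "?m x2 a = ?m a x2" if "a \<in> S n" for a using cent(2)[of "cj n a"] that by simp
  then obtain \<beta> where \<beta>: "x2 = rl \<beta>" using center_real[of n x2 \<gamma>] n x \<gamma> by blast
  have mulPQ: "P (?m b a) = ?m (P b) (cj n a) + ?m (P a) b" "Q (?m b a) = ?m (Q b) a + ?m (Q a) (cj n b)"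
    if ab: "a \<in> S n" "b \<in> S n" for a b
  proof -
    have "pair (P (?m b a)) (Q (?m b a)) = T (?M (pair b 0) (pair a 0))" using PQ[of "?m b a"] by simp
    also have "\<dots> = ?M (pair (P b) (Q b)) (cj (Suc n) (pair a 0)) + ?M (pair (P a) (Q a)) (pair b 0)"
      using T[of "pair b 0" "pair a 0"] ab PQ by simp
    finally show "P (?m b a) = ?m (P b) (cj n a) + ?m (P a) b" "Q (?m b a) = ?m (Q b) a + ?m (Q a) (cj n b)"
      using ab PQS by (simp_all add: pair_add)
  qed
  \<comment> \<open>The image of the product of \<open>pair a 0\<close> and \<open>pair 0 b\<close>
    is computed in two ways, by \<open>T0\<close> and by the twisted rule. It follows that
    \<open>Q a\<close> and \<open>P a - \<beta> *\<^sub>R a\<close> are central.\<close>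
  have comm: "?m (cj n b) (Q a) = ?m (Q a) (cj n b)"
      "?m (P a) b - ?m b (P a) = \<beta> *\<^sub>R (?m a b - ?m b a)"
    if ab: "a \<in> S n" "b \<in> S n" for a b
  proof -
    have "T (pair 0 (?m b a)) = T (?M (pair a 0) (pair 0 b))" using ab by simp
    also have "\<dots> = ?M (pair (P a) (Q a)) (cj (Suc n) (pair 0 b)) + ?M (T (pair 0 b)) (pair a 0)"
      using T[of "pair a 0" "pair 0 b"] ab PQ by simp
    finally have e: "T (pair 0 (?m b a)) = \<dots>" .
    have e1: "\<gamma> n *\<^sub>R ?m (cj n b) (Q a) = \<gamma> n *\<^sub>R ?m (Q a) (cj n b)"
      and e2: "?m (P a) b - ?m b (P a) = \<beta> *\<^sub>R (?m (cj n a) (cj n b) - ?m (cj n b) (cj n a))"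
      using e ab PQS[OF ab(1)] PQS[OF ab(2)]
      by (auto simp: T0 \<alpha> \<beta> pair_add mulPQ cj_mul mul_distrib algebra_simps)
    show "?m (cj n b) (Q a) = ?m (Q a) (cj n b)" using e1 \<gamma> by simp
    show "?m (P a) b - ?m b (P a) = \<beta> *\<^sub>R (?m a b - ?m b a)"
      using e2 commutator_cj[OF ab, of \<gamma>] by simp
  qed
  have "\<exists>r. Q a = rl r" if a: "a \<in> S n" for a
  proof -
    have "?m (Q a) b = ?m b (Q a)" if "b \<in> S n" for b using comm(1)[of a "cj n b"] a that by simp
    then show ?thesis using center_real[of n "Q a" \<gamma>] n PQS[OF a] \<gamma> by blast
  qed
  then obtain \<kappa> where \<kappa>: "\<And>a. a \<in> S n \<Longrightarrow> Q a = rl (\<kappa> a)" by metis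
  have "\<exists>r. P a = \<beta> *\<^sub>R a + rl r" if a: "a \<in> S n" for a
  proof -
    have "?m (P a - \<beta> *\<^sub>R a) b = ?m b (P a - \<beta> *\<^sub>R a)" if "b \<in> S n" for b
      using comm(2)[OF a that] by (simp add: mul_distrib scaleR_diff_right algebra_simps)
    then obtain r where "P a - \<beta> *\<^sub>R a = rl r"
      using center_real[of n "P a - \<beta> *\<^sub>R a" \<gamma>] n PQS[OF a] a \<gamma> by blast
    then show ?thesis by (metis add.commute diff_add_cancel)
  qed
  then obtain \<pi> where \<pi>: "\<And>a. a \<in> S n \<Longrightarrow> P a = \<beta> *\<^sub>R a + rl (\<pi> a)" by metis
  \<comment> \<open>Only the real data \<alpha>, \<beta>, \<pi> and \<kappa> are left. Testing the
    product rules on quaternion units and comparing coefficients makes \<beta>, \<pi> and \<kappa>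
    vanish in turn.\<close>
  let ?i = "ii n" and ?j = "jj n"
  note ji = mul_jj_ii[OF n, of \<gamma>]
  have "rl (\<pi> (?m ?i ?j)) + (- \<pi> ?j) *\<^sub>R ?i + \<pi> ?i *\<^sub>R ?j + (3 * \<beta>) *\<^sub>R ?m ?i ?j = 0"
    using mulPQ(1)[of ?j ?i] by (simp add: \<pi> mul_distrib ji) (simp add: vec_eq_iff algebra_simps)
  then have "3 * \<beta> = 0" using quaternion_independent(4)[OF n] by blast
  then have \<beta>0: "\<beta> = 0" by simp
  have "rl (\<pi> (?m ?j ?i)) + \<pi> ?j *\<^sub>R ?i + (- \<pi> ?i) *\<^sub>R ?j + 0 *\<^sub>R ?m ?i ?j = 0"
    using mulPQ(1)[of ?i ?j] by (simp add: \<pi> \<beta>0)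
  then have "- \<pi> ?i = 0" using quaternion_independent(3)[OF n] by blast
  then have \<pi>i: "\<pi> ?i = 0" by simp
  have \<pi>0: "\<pi> a = 0" if a: "a \<in> S n" for a
  proof -
    have "rl (\<pi> (?m a ?i)) + \<pi> a *\<^sub>R ?i + 0 *\<^sub>R ?j + 0 *\<^sub>R ?m ?i ?j = 0"
      using mulPQ(1)[of ?i a] a by (simp add: \<pi> \<beta>0 \<pi>i)
    then show ?thesis using quaternion_independent(2)[OF n] by blast
  qed
  have "rl (\<kappa> (?m ?j ?i)) + (- \<kappa> ?j) *\<^sub>R ?i + \<kappa> ?i *\<^sub>R ?j + 0 *\<^sub>R ?m ?i ?j = 0"
    using mulPQ(2)[of ?i ?j] by (simp add: \<kappa>)
  then have \<kappa>i: "\<kappa> ?i = 0" using quaternion_independent(3)[OF n] by blast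
  have \<kappa>0: "\<kappa> a = 0" if a: "a \<in> S n" for a
  proof -
    have "rl (\<kappa> (?m a ?i)) + (- \<kappa> a) *\<^sub>R ?i + 0 *\<^sub>R ?j + 0 *\<^sub>R ?m ?i ?j = 0"
      using mulPQ(2)[of ?i a] a by (simp add: \<kappa> \<kappa>i)
    then have "- \<kappa> a = 0" using quaternion_independent(2)[OF n] by blast
    then show ?thesis by simp
  qed
  have T1: "T (pair a 0) = 0" and T2: "T (pair 0 a) = pair (\<alpha> *\<^sub>R a) 0" if "a \<in> S n" for a
    using that by (simp_all add: PQ T0 \<alpha> \<beta> \<beta>0 \<pi> \<pi>0 \<kappa> \<kappa>0)
  \<comment> \<open>This product lies in the first half, where \<open>T\<close> vanishes, while the
    twisted rule gives twice \<alpha> times a quaternion unit.\<close>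
  have "T (?M (pair 0 ?i) (pair 0 ?j)) = 0" using T1[of "\<gamma> n *\<^sub>R ?m (cj n ?j) ?i"] by simp
  then have "\<alpha> *\<^sub>R ?m ?i ?j + \<alpha> *\<^sub>R ?m ?i ?j = 0"
    using T[of "pair 0 ?i" "pair 0 ?j"] by (simp add: T2 pair_add pair_minus ji)
  then have "rl 0 + 0 *\<^sub>R ?i + 0 *\<^sub>R ?j + (2 * \<alpha>) *\<^sub>R ?m ?i ?j = 0"
    by (simp add: scaleR_add_left [symmetric])
  then have "2 * \<alpha> = 0" using quaternion_independent(4)[OF n] by blast
  moreover obtain a b where "y = pair a b" "a \<in> S n" "b \<in> S n" using y by (auto elim: S_SucE)
  moreover from this have "T y = T (pair a 0) + T (pair 0 b)"
    using L(2)[of "pair a 0" "pair 0 b"] by (simp add: pair_add)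
  ultimately show ?thesis by (simp add: T1 T2)
qed

definition der :: "(nat \<Rightarrow> real) \<Rightarrow> nat \<Rightarrow> (vec \<Rightarrow> vec) \<Rightarrow> bool" where
  "der \<gamma> k D \<longleftrightarrow> lin k k D \<and>
     (\<forall>x\<in>S k. \<forall>y\<in>S k. D (mul \<gamma> k x y) = mul \<gamma> k (D x) y + mul \<gamma> k x (D y))"

lemma derD:
  assumes "der \<gamma> k D"
  shows "lin k k D"
    "x \<in> S k \<Longrightarrow> y \<in> S k \<Longrightarrow> D (mul \<gamma> k x y) = mul \<gamma> k (D x) y + mul \<gamma> k x (D y)"
  using assms by (auto simp: der_def)

lemma der_rl [simp]:
  assumes "der \<gamma> k D"
  shows "D (rl r) = 0"
proof -
  note L = linD[OF derD(1)[OF assms]]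
  have "D e0 + D e0 = D e0" using derD(2)[OF assms, of e0 e0] L(1) by simp
  then have "D e0 = 0" by simp
  moreover have "rl r = r *\<^sub>R e0" by (simp add: rl_linear)
  ultimately show ?thesis using L(3)[of e0 r] by simp
qed

text \<open>First \<open>D\<close> is shown to kill the last generator \<open>?q\<close>. Then the
  first component of \<open>D\<close> on the first half is a derivation, the second component is
  twisted and hence zero, and \<open>pair a b\<close> is \<open>pair a 0\<close> plus
  \<open>pair b 0\<close> times \<open>?q\<close>.\<close>

lemma der_pair:
  assumes m: "m \<ge> 3" and \<gamma>: "\<And>i. i \<le> m \<Longrightarrow> \<gamma> i \<noteq> 0" and D: "der \<gamma> (Suc m) D"
  obtains D0 where "der \<gamma> m D0" "\<And>a b. a \<in> S m \<Longrightarrow> b \<in> S m \<Longrightarrow> D (pair a b) = pair (D0 a) (D0 b)"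
proof -
  let ?m = "mul \<gamma> m" and ?M = "mul \<gamma> (Suc m)" and ?q = "pair 0 e0"
  note L = linD[OF derD(1)[OF D]] and leib = derD(2)[OF D]
  have g: "\<gamma> 0 \<noteq> 0" "\<gamma> 1 \<noteq> 0" "\<gamma> m \<noteq> 0" using \<gamma> m by auto
  have altq: "?M v (?M v ?q) = ?M (?M v v) ?q" if v: "v \<in> S (Suc m)" for v
  proof -
    obtain a b where ab: "v = pair a b" "a \<in> S m" "b \<in> S m" using v by (auto elim: S_SucE)
    obtain r where "a + cj m a = rl r" using add_cj_real ab by blast
    then have r: "cj m a = rl r - a" by (simp add: algebra_simps)
    show ?thesis unfolding ab using ab by (simp add: mul_distrib mul_cj_self r pair_scaleR rl_linear algebra_simps)
  qed
  have pol: "?M v (?M w ?q) + ?M w (?M v ?q) = ?M (?M v w + ?M w v) ?q"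
    if "v \<in> S (Suc m)" "w \<in> S (Suc m)" for v w
    using altq[of "v + w"] altq[of v] altq[of w] that by (simp add: mul_distrib algebra_simps)
  \<comment> \<open>Differentiating \<open>altq\<close>: the terms containing \<open>D v\<close>
    cancel by the linearised identity \<open>pol\<close>, so \<open>D ?q\<close> inherits the
    identity of \<open>?q\<close>.\<close>
  have alt: "?M v (?M v (D ?q)) = ?M (?M v v) (D ?q)" if v: "v \<in> S (Suc m)" for v
  proof -
    have "D (?M v (?M v ?q)) = ?M (D v) (?M v ?q) + ?M v (?M (D v) ?q + ?M v (D ?q))"
      using leib v L(1) by simp
    moreover have "D (?M (?M v v) ?q) = ?M (?M (D v) v + ?M v (D v)) ?q + ?M (?M v v) (D ?q)"
      using leib v L(1) by simp
    moreover note pol[OF v L(1)[OF v]] altq[OF v]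
    ultimately show ?thesis by (simp add: mul_distrib algebra_simps)
  qed
  have "D ?q \<in> S (Suc m)" using L(1) by simp
  then obtain c d where cd: "D ?q = pair c d" "c \<in> S m" "d \<in> S m" by (auto elim: S_SucE)
  obtain r s where "c = rl r" "d = rl s"
    using alternating_pair_real[OF m cd(2,3) g] alt unfolding cd(1) by blast
  then have rs: "D ?q = pair (rl r) (rl s)" using cd by simp
  \<comment> \<open>The square of \<open>?q\<close> is real, so its derivative vanishes, which
    leaves no room for nonzero \<open>r\<close> or \<open>s\<close>.\<close>
  have "?M ?q ?q = rl (\<gamma> m)" by (simp add: pair_rl_0 rl_linear)
  then have "?M (D ?q) ?q + ?M ?q (D ?q) = 0" using leib[of ?q ?q] D by simp
  then have "r = 0 \<and> s = 0" using g by (simp add: rs pair_add rl_linear)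
  then have q: "D ?q = 0" using rs by simp
  define D0 where "D0 a = p1 (D (pair a 0))" for a
  define T where "T a = p2 (D (pair a 0))" for a
  have DT: "D (pair a 0) = pair (D0 a) (T a)" for a by (simp add: D0_def T_def)
  have S: "D0 a \<in> S m" "T a \<in> S m" if "a \<in> S m" for a
    using L(1)[of "pair a 0"] that unfolding DT by auto
  have "lin m m D0 \<and> lin m m T"
    unfolding lin_def
  proof (intro conjI ballI allI)
    fix x y r assume xy: "x \<in> S m" "y \<in> S m"
    show "D0 x \<in> S m" "T x \<in> S m" using S xy by auto
    show "D0 (x + y) = D0 x + D0 y" "T (x + y) = T x + T y"
      using L(2)[of "pair x 0" "pair y 0"] xy by (simp_all add: DT pair_add)
    show "D0 (r *\<^sub>R x) = r *\<^sub>R D0 x" "T (r *\<^sub>R x) = r *\<^sub>R T x"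
      using L(3)[of "pair x 0" r] xy by (simp_all add: DT pair_scaleR)
  qed
  then have lins: "lin m m D0" "lin m m T" by auto
  have prod: "D0 (?m a c) = ?m (D0 a) c + ?m a (D0 c)" "T (?m a c) = ?m (T a) (cj m c) + ?m (T c) a"
    if ac: "a \<in> S m" "c \<in> S m" for a c
    using leib[of "pair a 0" "pair c 0"] ac S by (simp_all add: DT pair_add)
  obtain n where n: "m = Suc n" "n \<ge> 2" using m by (cases m) auto
  have T0: "T a = 0" if "a \<in> S m" for a
    using twisted_derivation_eq_0[of n \<gamma> T a] n lins(2) prod(2) that \<gamma> g by auto
  have "der \<gamma> m D0" using lins(1) prod(1) by (simp add: der_def)
  moreover have "D (pair a b) = pair (D0 a) (D0 b)" if ab: "a \<in> S m" "b \<in> S m" for a b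
  proof -
    have "pair a b = pair a 0 + ?M (pair b 0) ?q" using ab by (simp add: pair_add)
    also have "D \<dots> = D (pair a 0) + ?M (D (pair b 0)) ?q"
      using ab L(2)[of "pair a 0" "?M (pair b 0) ?q"] leib[of "pair b 0" ?q] q by simp
    finally show ?thesis using ab S by (simp add: DT T0 pair_add)
  qed
  ultimately show ?thesis using that by blast
qed


section \<open>Entrywise extensions\<close>

text \<open>An element of \<open>S (k + r)\<close> is an array of \<open>2 ^ r\<close> entries from
  \<open>S k\<close>; \<open>lift r f\<close> applies \<open>f\<close> to each of them, and
  \<open>up r\<close> places its argument in the first entry.\<close>

primrec lift :: "nat \<Rightarrow> (vec \<Rightarrow> vec) \<Rightarrow> vec \<Rightarrow> vec" where
  "lift 0 f x = f x"
| "lift (Suc r) f x = pair (lift r f (p1 x)) (lift r f (p2 x))"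

primrec up :: "nat \<Rightarrow> vec \<Rightarrow> vec" where
  "up 0 x = x"
| "up (Suc r) x = pair (up r x) 0"

lemma up_in_S [simp]: "x \<in> S k \<Longrightarrow> up r x \<in> S (k + r)"
  by (induction r) auto

lemma up_linear: "up r (- x) = - up r x" "up r (x + y) = up r x + up r y"
  by (induction r) (auto simp: pair_minus pair_add)

lemma up_eq_iff [simp]: "up r x = up r y \<longleftrightarrow> x = y"
  by (induction r) auto

lemma up_0 [simp]: "up r 0 = 0"
  by (induction r) auto

lemma lift_0: "f 0 = 0 \<Longrightarrow> lift r f 0 = 0"
  by (induction r) auto

lemma lift_up: "f 0 = 0 \<Longrightarrow> lift r f (up r x) = up r (f x)"
  by (induction r) (auto simp: lift_0)

lemma lift_lift: "lift r f (lift r g x) = lift r (\<lambda>x. f (g x)) x"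
  by (induction r arbitrary: x) auto

lemma lift_minus: "lift r (\<lambda>x. - f x) x = - lift r f x"
  by (induction r arbitrary: x) (auto simp: pair_minus)

lemma lift_zero: "lift r (\<lambda>x. 0) x = 0"
  by (induction r arbitrary: x) auto

lemma lift_cong:
  assumes "\<And>x. x \<in> S k \<Longrightarrow> f x = g x" "x \<in> S (k + r)"
  shows "lift r f x = lift r g x"
  using assms(2) by (induction r arbitrary: x) (auto simp: assms(1) S.simps)

lemma lift_lin:
  assumes "lin k l f"
  shows "lin (k + r) (l + r) (lift r f)"
proof (induction r)
  case (Suc r)
  show ?case unfolding lin_def
    using linD[OF Suc] by (auto simp: S.simps pair_add pair_scaleR)
qed (use assms in \<open>simp add: lin_def\<close>)

lemma lift_inj_on:
  assumes "inj_on f (S k)"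
  shows "inj_on (lift r f) (S (k + r))"
proof (induction r)
  case 0
  have "lift 0 f = f" by (rule ext) simp
  then show ?case using assms by simp
next
  case (Suc r)
  then show ?case
    by (auto simp: inj_on_def S.simps) (metis pair_p1_p2)
qed

text \<open>Products of pairs involve conjugates, so compatibility with conjugation is what allows a
  homomorphism to be extended to doubles. The two levels may differ, because quaternions are mapped
  into octonions later.\<close>

definition star_hom :: "(nat \<Rightarrow> real) \<Rightarrow> nat \<Rightarrow> (nat \<Rightarrow> real) \<Rightarrow> nat \<Rightarrow> (vec \<Rightarrow> vec) \<Rightarrow> bool" where
  "star_hom \<gamma> k \<delta> l f \<longleftrightarrow> lin k l f \<and> f e0 = e0 \<and> (\<forall>x\<in>S k. f (cj k x) = cj l (f x)) \<and>
     (\<forall>x\<in>S k. \<forall>y\<in>S k. f (mul \<gamma> k x y) = mul \<delta> l (f x) (f y))"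

lemma star_homD:
  assumes "star_hom \<gamma> k \<delta> l f"
  shows "lin k l f" "f e0 = e0" "x \<in> S k \<Longrightarrow> f (cj k x) = cj l (f x)"
    "x \<in> S k \<Longrightarrow> y \<in> S k \<Longrightarrow> f (mul \<gamma> k x y) = mul \<delta> l (f x) (f y)"
  using assms by (auto simp: star_hom_def)

lemma lift_star_hom:
  assumes "star_hom \<gamma> k \<delta> l f" "\<And>s. s < r \<Longrightarrow> \<gamma> (k + s) = \<delta> (l + s)"
  shows "star_hom \<gamma> (k + r) \<delta> (l + r) (lift r f)"
  using assms(2)
proof (induction r)
  case 0
  then show ?case using assms(1) by (simp add: star_hom_def lin_def)
next
  case (Suc r)
  then have IH: "star_hom \<gamma> (k + r) \<delta> (l + r) (lift r f)" by simp
  note I = star_homD[OF IH] and L = linD[OF star_homD(1)[OF IH]]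
  have g: "\<gamma> (k + r) = \<delta> (l + r)" using Suc.prems by simp
  have "lin (k + Suc r) (l + Suc r) (lift (Suc r) f)"
    by (rule lift_lin) (use assms(1) in \<open>simp add: star_hom_def\<close>)
  moreover have "lift (Suc r) f e0 = e0" using I(2) L(5) by (simp add: pair_rl_0)
  moreover have "lift (Suc r) f (cj (k + Suc r) x) = cj (l + Suc r) (lift (Suc r) f x)"
    if "x \<in> S (k + Suc r)" for x
    using that by (auto simp: I L S.simps cj.simps)
  moreover have "lift (Suc r) f (mul \<gamma> (k + Suc r) x y)
      = mul \<delta> (l + Suc r) (lift (Suc r) f x) (lift (Suc r) f y)"
    if "x \<in> S (k + Suc r)" "y \<in> S (k + Suc r)" for x y
    using that by (auto simp: I L S.simps mul.simps g)
  ultimately show ?case unfolding star_hom_def by blast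
qed

lemma lift_der:
  assumes "der \<gamma> k D" "\<And>x. x \<in> S k \<Longrightarrow> D (cj k x) = cj k (D x)"
  shows "der \<gamma> (k + r) (lift r D)"
proof -
  have "der \<gamma> (k + r) (lift r D) \<and> (\<forall>x\<in>S (k + r). lift r D (cj (k + r) x) = cj (k + r) (lift r D x))"
  proof (induction r)
    case 0
    then show ?case using assms by (simp add: der_def lin_def)
  next
    case (Suc r)
    then have D: "der \<gamma> (k + r) (lift r D)" by simp
    note L = linD[OF derD(1)[OF D]]
    have "lin (k + Suc r) (k + Suc r) (lift (Suc r) D)" using assms(1) by (intro lift_lin derD(1))
    moreover have "lift (Suc r) D (mul \<gamma> (k + Suc r) x y)
        = mul \<gamma> (k + Suc r) (lift (Suc r) D x) y + mul \<gamma> (k + Suc r) x (lift (Suc r) D y)"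
      if "x \<in> S (k + Suc r)" "y \<in> S (k + Suc r)" for x y
      using that Suc by (auto simp: L derD(2)[OF D] S.simps mul.simps pair_add scaleR_add_right algebra_simps)
    moreover have "lift (Suc r) D (cj (k + Suc r) x) = cj (k + Suc r) (lift (Suc r) D x)"
      if "x \<in> S (k + Suc r)" for x
      using that Suc by (auto simp: L S.simps cj.simps)
    ultimately show ?case unfolding der_def by blast
  qed
  then show ?thesis by simp
qed

text \<open>Iterates \<open>der_pair\<close> down to level 3.\<close>

lemma der_lift_octonion:
  assumes "\<And>i. i < 3 + r \<Longrightarrow> \<gamma> i \<noteq> 0" "der \<gamma> (3 + r) D"
  obtains D0 where "der \<gamma> 3 D0" "\<And>x. x \<in> S (3 + r) \<Longrightarrow> D x = lift r D0 x"
proof -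
  have "\<exists>D0. der \<gamma> 3 D0 \<and> (\<forall>x\<in>S (3 + r). D x = lift r D0 x)"
    using assms
  proof (induction r arbitrary: D)
    case 0
    then show ?case by auto
  next
    case (Suc r)
    obtain D1 where D1: "der \<gamma> (3 + r) D1"
        "\<And>a b. a \<in> S (3 + r) \<Longrightarrow> b \<in> S (3 + r) \<Longrightarrow> D (pair a b) = pair (D1 a) (D1 b)"
      using der_pair[of "3 + r" \<gamma> D] Suc.prems by auto
    obtain D0 where "der \<gamma> 3 D0" "\<forall>x\<in>S (3 + r). D1 x = lift r D0 x" using Suc.IH[OF _ D1(1)] Suc.prems by auto
    moreover from this have "D x = lift (Suc r) D0 x" if "x \<in> S (3 + Suc r)" for x
      using S_SucE[OF that[unfolded add_Suc_right]] D1(2) by (metis lift.simps(2) p1_pair p2_pair)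
    ultimately show ?case by blast
  qed
  then show ?thesis using that by blast
qed

section \<open>Isomorphisms and transport of derivations\<close>

definition alg_iso :: "(nat \<Rightarrow> real) \<Rightarrow> (nat \<Rightarrow> real) \<Rightarrow> nat \<Rightarrow> (vec \<Rightarrow> vec) \<Rightarrow> bool" where
  "alg_iso \<gamma> \<delta> k h \<longleftrightarrow> lin k k h \<and> bij_betw h (S k) (S k) \<and>
     (\<forall>x\<in>S k. \<forall>y\<in>S k. h (mul \<gamma> k x y) = mul \<delta> k (h x) (h y))"

lemma alg_isoD:
  assumes "alg_iso \<gamma> \<delta> k h"
  shows "lin k k h" "bij_betw h (S k) (S k)" "inj_on h (S k)"
    "x \<in> S k \<Longrightarrow> y \<in> S k \<Longrightarrow> h (mul \<gamma> k x y) = mul \<delta> k (h x) (h y)"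
  using assms by (auto simp: alg_iso_def bij_betw_def)

lemma alg_iso_trans:
  assumes "alg_iso \<gamma> \<delta> k f" "alg_iso \<delta> \<epsilon> k g"
  shows "alg_iso \<gamma> \<epsilon> k (\<lambda>x. g (f x))"
proof -
  have "bij_betw (g \<circ> f) (S k) (S k)" using assms alg_isoD(2) bij_betw_trans by blast
  then show ?thesis using assms unfolding alg_iso_def lin_def by (auto simp: comp_def)
qed

lemma alg_iso_sym:
  assumes "alg_iso \<gamma> \<delta> k h"
  shows "alg_iso \<delta> \<gamma> k (inv_into (S k) h)"
proof -
  let ?g = "inv_into (S k) h"
  note L = linD[OF alg_isoD(1)[OF assms]] and I = alg_isoD[OF assms]
  have g: "?g x \<in> S k" "h (?g x) = x" if "x \<in> S k" for x
    using that I(2) by (auto simp: bij_betw_def inv_into_into f_inv_into_f)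
  have eq: "?g x = y" if "x \<in> S k" "y \<in> S k" "h y = x" for x y
    using that inv_into_f_f[OF I(3)] by auto
  have "lin k k ?g" unfolding lin_def
    by (intro conjI ballI allI) (auto intro!: eq simp: g L)
  moreover have "bij_betw ?g (S k) (S k)" using I(2) by (rule bij_betw_inv_into)
  ultimately show ?thesis unfolding alg_iso_def by (auto intro!: eq simp: g I)
qed

lemma transport_der:
  assumes h: "alg_iso \<gamma> \<delta> k h" and D: "der \<gamma> k D"
  obtains D' where "der \<delta> k D'" "\<And>x. x \<in> S k \<Longrightarrow> D' (h x) = h (D x)"
proof
  let ?g = "inv_into (S k) h"
  note Lh = linD[OF alg_isoD(1)[OF h]] and Lg = linD[OF alg_isoD(1)[OF alg_iso_sym[OF h]]]
    and LD = linD[OF derD(1)[OF D]]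
  have hg: "h (?g x) = x" if "x \<in> S k" for x
    using that alg_isoD(2)[OF h] by (auto simp: bij_betw_def f_inv_into_f)
  show "der \<delta> k (\<lambda>y. h (D (?g y)))" unfolding der_def
  proof (intro conjI ballI)
    show "lin k k (\<lambda>y. h (D (?g y)))" unfolding lin_def by (auto simp: Lh Lg LD)
    fix x y assume "x \<in> S k" "y \<in> S k"
    then show "h (D (?g (mul \<delta> k x y))) = mul \<delta> k (h (D (?g x))) y + mul \<delta> k x (h (D (?g y)))"
      by (simp add: alg_isoD(4)[OF alg_iso_sym[OF h]] derD(2)[OF D] Lh Lg LD alg_isoD(4)[OF h] hg)
  qed
  show "h (D (?g (h x))) = h (D x)" if "x \<in> S k" for x
    using that alg_isoD(3)[OF h] by simp
qed

section \<open>Composition law for quaternion and octonion norms\<close>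

lemmas level_3 [simp] = pair_in_S[of _ _ 2, simplified] mul_pair[where k = 2, simplified]
  cj_pair[where k = 2, simplified] ip_pair[where k = 2, simplified]

lemma S_2E:
  assumes "x \<in> S 2"
  obtains a b c d where "x = pair (pair (rl a) (rl b)) (pair (rl c) (rl d))"
proof -
  have 1: "\<exists>a b. y = pair (rl a) (rl b)" if "y \<in> S 1" for y
    using that by (metis One_nat_def S_SucE S.simps(1) imageE)
  have "x \<in> S (Suc 1)" using assms by (simp add: numeral_2_eq_2)
  then obtain y z where "x = pair y z" "y \<in> S 1" "z \<in> S 1" by (elim S_SucE)
  then show ?thesis using 1 that by metis
qed

lemma mul_2:
  "mul \<gamma> 2 (pair (pair (rl a) (rl b)) (pair (rl c) (rl d))) (pair (pair (rl e) (rl f)) (pair (rl g) (rl h)))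
   = pair (pair (rl (a * e + \<gamma> 0 * b * f + \<gamma> 1 * (c * g - \<gamma> 0 * d * h)))
                (rl (a * f + b * e + \<gamma> 1 * (d * g - c * h))))
          (pair (rl (a * g + \<gamma> 0 * b * h + c * e - \<gamma> 0 * d * f))
                (rl (a * h + b * g + d * e - c * f)))"
  by (simp add: numeral_2_eq_2 pair_add pair_scaleR rl_linear pair_minus algebra_simps)

lemma mul_2_assoc:
  assumes "x \<in> S 2" "y \<in> S 2" "z \<in> S 2"
  shows "mul \<gamma> 2 (mul \<gamma> 2 x y) z = mul \<gamma> 2 x (mul \<gamma> 2 y z)"
proof -
  obtain a b c d where x: "x = pair (pair (rl a) (rl b)) (pair (rl c) (rl d))" using S_2E assms(1) .
  obtain e f g h where y: "y = pair (pair (rl e) (rl f)) (pair (rl g) (rl h))" using S_2E assms(2) .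
  obtain p q r s where z: "z = pair (pair (rl p) (rl q)) (pair (rl r) (rl s))" using S_2E assms(3) .
  show ?thesis unfolding x y z mul_2 by (simp add: algebra_simps)
qed

lemma ip_mul_2:
  assumes "x \<in> S 2" "y \<in> S 2"
  shows "ip \<gamma> 2 (mul \<gamma> 2 x y) (mul \<gamma> 2 x y) = ip \<gamma> 2 x x * ip \<gamma> 2 y y"
proof -
  have "rl (ip \<gamma> 2 (mul \<gamma> 2 x y) (mul \<gamma> 2 x y)) = mul \<gamma> 2 (mul \<gamma> 2 x y) (mul \<gamma> 2 (cj 2 y) (cj 2 x))"
    using assms by (simp add: mul_cj_self(1)[symmetric] cj_mul)
  also have "\<dots> = mul \<gamma> 2 x (mul \<gamma> 2 (mul \<gamma> 2 y (cj 2 y)) (cj 2 x))"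
    using assms by (simp add: mul_2_assoc)
  also have "\<dots> = rl (ip \<gamma> 2 x x * ip \<gamma> 2 y y)"
    using assms by (simp add: mul_cj_self rl_linear)
  finally show ?thesis by simp
qed

text \<open>Expanding both components by the composition law of the quaternions leaves two cross
  terms with opposite signs. They agree by the adjoint rules and the associativity of quaternions,
  which is \<open>cross\<close>.\<close>

lemma ip_mul_3:
  assumes "x \<in> S 3" "y \<in> S 3"
  shows "ip \<gamma> 3 (mul \<gamma> 3 x y) (mul \<gamma> 3 x y) = ip \<gamma> 3 x x * ip \<gamma> 3 y y"
proof -
  have 3: "3 = Suc 2" by simp
  obtain a b where x: "x = pair a b" "a \<in> S 2" "b \<in> S 2" using assms(1) unfolding 3 by (elim S_SucE)
  obtain c d where y: "y = pair c d" "c \<in> S 2" "d \<in> S 2" using assms(2) unfolding 3 by (elim S_SucE)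
  let ?m = "mul \<gamma> 2" and ?i = "ip \<gamma> 2"
  have "?i (?m (cj 2 d) b) (?m a c) = ?i b (?m d (?m a c))" using ip_mul(1)[of \<gamma> 2 "cj 2 d" b] by simp
  also have "\<dots> = ?i b (?m (?m d a) c)" using x y by (simp add: mul_2_assoc)
  also have "\<dots> = ?i (?m b (cj 2 c)) (?m d a)" using ip_mul(2)[of \<gamma> 2 b "cj 2 c"] by simp
  finally have cross: "?i (?m (cj 2 d) b) (?m a c) = ?i (?m b (cj 2 c)) (?m d a)" .
  have nc: "?i (cj 2 u) (cj 2 u) = ?i u u" if "u \<in> S 2" for u
    using mul_cj_self(1)[of "cj 2 u" 2 \<gamma>] mul_cj_self(2)[of u 2 \<gamma>] that by simp
  show ?thesis unfolding x y using x y cross ip_commute[of \<gamma> 2 "?m a c" "?m (cj 2 d) b"]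
      ip_commute[of \<gamma> 2 "?m d a" "?m b (cj 2 c)"]
    by (simp add: ip_mul_2 nc algebra_simps)
qed

lemma ip_mul_left_3:
  assumes "x \<in> S 3" "y \<in> S 3" "z \<in> S 3"
  shows "ip \<gamma> 3 (mul \<gamma> 3 x y) (mul \<gamma> 3 x z) = ip \<gamma> 3 x x * ip \<gamma> 3 y z"
    and "ip \<gamma> 3 (mul \<gamma> 3 y x) (mul \<gamma> 3 z x) = ip \<gamma> 3 x x * ip \<gamma> 3 y z"
  using ip_mul_3[of x "y + z" \<gamma>] ip_mul_3[of x y \<gamma>] ip_mul_3[of x z \<gamma>]
    ip_mul_3[of "y + z" x \<gamma>] ip_mul_3[of y x \<gamma>] ip_mul_3[of z x \<gamma>] assms
    ip_commute[of \<gamma> 3 y z] ip_commute[of \<gamma> 3 "mul \<gamma> 3 x y" "mul \<gamma> 3 x z"]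
    ip_commute[of \<gamma> 3 "mul \<gamma> 3 y x" "mul \<gamma> 3 z x"]
  by (simp_all add: mul_distrib algebra_simps)

text \<open>Tested against an arbitrary element, the adjoint rule turns this into the polarised
  composition law; nondegeneracy of the form gives the equation.\<close>

lemma mul_cj_cancel_3:
  assumes "x \<in> S 3" "y \<in> S 3" and \<gamma>: "\<And>i. i < 3 \<Longrightarrow> \<gamma> i \<noteq> 0"
  shows "mul \<gamma> 3 (cj 3 x) (mul \<gamma> 3 x y) = ip \<gamma> 3 x x *\<^sub>R y"
    and "mul \<gamma> 3 (mul \<gamma> 3 y x) (cj 3 x) = ip \<gamma> 3 x x *\<^sub>R y"
proof -
  have "mul \<gamma> 3 (cj 3 x) (mul \<gamma> 3 x y) - ip \<gamma> 3 x x *\<^sub>R y = 0"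
    by (rule ip_nondegenerate[of _ 3 \<gamma>])
      (use assms ip_mul(1)[of \<gamma> 3 "cj 3 x" "mul \<gamma> 3 x y"] in \<open>auto simp: ip_mul_left_3\<close>)
  then show "mul \<gamma> 3 (cj 3 x) (mul \<gamma> 3 x y) = ip \<gamma> 3 x x *\<^sub>R y" by simp
  have "mul \<gamma> 3 (mul \<gamma> 3 y x) (cj 3 x) - ip \<gamma> 3 x x *\<^sub>R y = 0"
    by (rule ip_nondegenerate[of _ 3 \<gamma>])
      (use assms ip_mul(2)[of \<gamma> 3 "mul \<gamma> 3 y x" "cj 3 x"] in \<open>auto simp: ip_mul_left_3\<close>)
  then show "mul \<gamma> 3 (mul \<gamma> 3 y x) (cj 3 x) = ip \<gamma> 3 x x *\<^sub>R y" by simp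
qed

section \<open>Imaginary elements and skewness of derivations\<close>

lemma imaginary_anticommute:
  assumes "x \<in> S k" "y \<in> S k" "cj k x = - x" "cj k y = - y"
  shows "mul \<gamma> k x y + mul \<gamma> k y x = rl (- 2 * ip \<gamma> k x y)"
proof -
  have "- mul \<gamma> k x y - mul \<gamma> k y x = rl (2 * ip \<gamma> k x y)"
    using mul_cj_add(1)[OF assms(1,2), of \<gamma>] assms(3,4) by simp
  then have "- (mul \<gamma> k x y + mul \<gamma> k y x) = rl (2 * ip \<gamma> k x y)" by (simp add: algebra_simps)
  then have "mul \<gamma> k x y + mul \<gamma> k y x = - rl (2 * ip \<gamma> k x y)" by (metis minus_minus)
  then show ?thesis by (simp add: rl_linear)
qed

lemma ip_rl_imaginary:
  assumes "y \<in> S k" "cj k y = - y"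
  shows "ip \<gamma> k (rl r) y = 0"
  using mul_cj_add(1)[of "rl r" k y \<gamma>] assms by simp

text \<open>For imaginary \<open>z\<close> the square is real, so differentiating it shows that
  \<open>D z\<close> anticommutes with \<open>z\<close>. With the trace \<open>t\<close> of
  \<open>D z\<close>, the element \<open>t *\<^sub>R z\<close> is then both real and imaginary,
  hence zero. The general case follows by subtracting the real part.\<close>

lemma der_imaginary:
  assumes D: "der \<gamma> k D" and x: "x \<in> S k"
  shows "cj k (D x) = - D x" "ip \<gamma> k x (D x) = 0"
proof -
  note L = linD[OF derD(1)[OF D]]
  have imag: "cj k (D z) = - D z \<and> ip \<gamma> k z (D z) = 0" if z: "z \<in> S k" "cj k z = - z" for z
  proof -
    let ?y = "D z"
    have y: "?y \<in> S k" using L z by auto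
    have "mul \<gamma> k z z = rl (- ip \<gamma> k z z)" using mul_cj_self(1)[OF z(1), of \<gamma>] z(2)
      by (simp add: rl_linear(3)[symmetric]) (metis minus_minus)
    then have 0: "mul \<gamma> k ?y z + mul \<gamma> k z ?y = 0" using derD(2)[OF D z(1) z(1)] D by simp
    obtain t where t: "?y + cj k ?y = rl t" using add_cj_real y by blast
    then have cjy: "cj k ?y = rl t - ?y" by (simp add: algebra_simps)
    have "t *\<^sub>R z - (mul \<gamma> k ?y z + mul \<gamma> k z ?y) = rl (2 * ip \<gamma> k z ?y)"
      using mul_cj_add(1)[OF z(1) y, of \<gamma>] z by (simp add: cjy mul_distrib algebra_simps)
    then have e: "t *\<^sub>R z = rl (2 * ip \<gamma> k z ?y)" using 0 by simp
    then have "cj k (t *\<^sub>R z) = t *\<^sub>R z" by simp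
    then have "t *\<^sub>R z + t *\<^sub>R z = 0" using z by (simp add: neg_eq_iff_add_eq_0)
    then have "(t + t) *\<^sub>R z = 0" by (simp only: scaleR_left_distrib)
    then have tz: "t *\<^sub>R z = 0" by simp
    then have "ip \<gamma> k z ?y = 0" using e by simp
    moreover have "cj k ?y = - ?y"
    proof (cases "t = 0")
      case True
      then show ?thesis using cjy by simp
    next
      case False
      then have "z = 0" using tz by simp
      then show ?thesis using L by simp
    qed
    ultimately show ?thesis by simp
  qed
  obtain r where r: "x + cj k x = rl r" using add_cj_real x by blast
  define z where "z = x - rl (r / 2)"
  have cx: "cj k x = rl r - x" using r by (simp add: algebra_simps)
  have "rl r = rl (r / 2) + rl (r / 2)" by (simp add: rl_linear)
  then have z: "z \<in> S k" "cj k z = - z" using x by (simp_all add: z_def cx)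
  have Dz: "D z = D x" using x D by (simp add: z_def L)
  show 1: "cj k (D x) = - D x" using imag[OF z] Dz by simp
  have "ip \<gamma> k (rl (r / 2)) (D x) = 0" using 1 x L by (intro ip_rl_imaginary) auto
  then show "ip \<gamma> k x (D x) = 0" using imag[OF z] Dz by (simp add: z_def)
qed

lemma der_skew:
  assumes D: "der \<gamma> k D" and x: "x \<in> S k" "y \<in> S k"
  shows "ip \<gamma> k (D x) y = - ip \<gamma> k x (D y)"
proof -
  note L = linD[OF derD(1)[OF D]]
  note der_imaginary(2)[OF D S_closed(1)[OF x]]
  then show ?thesis using der_imaginary(2)[OF D x(1)] der_imaginary(2)[OF D x(2)] x
    by (simp add: L ip_commute[of \<gamma> k y "D x"])
qed

lemma ip_pos:
  assumes "\<And>i. i < k \<Longrightarrow> \<gamma> i = - 1" "x \<in> S k" "x \<noteq> 0"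
  shows "ip \<gamma> k x x > 0"
proof -
  have "0 \<le> ip \<gamma> k x x \<and> (ip \<gamma> k x x = 0 \<longrightarrow> x = 0)" using assms(1,2)
  proof (induction k arbitrary: x)
    case 0
    then show ?case by (auto simp: ip.simps S.simps)
  next
    case (Suc k)
    then obtain a b where "x = pair a b" "a \<in> S k" "b \<in> S k" by (auto elim: S_SucE)
    then show ?case using Suc.IH[of a] Suc.IH[of b] Suc.prems by (auto simp: add_nonneg_eq_0_iff)
  qed
  then show ?thesis using assms(3) by force
qed

text \<open>An element of the kernel has norm 0, because its norm times the unit is mapped to 0; the
  form is definite.\<close>

lemma star_hom_inj_of_definite:
  assumes "star_hom \<gamma> k \<delta> l f" "\<And>i. i < k \<Longrightarrow> \<gamma> i = - 1"
  shows "inj_on f (S k)"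
proof (rule inj_onI)
  note L = linD[OF star_homD(1)[OF assms(1)]]
  have *: "z = 0" if z: "z \<in> S k" "f z = 0" for z
  proof (rule ccontr)
    assume "z \<noteq> 0"
    then have p: "ip \<gamma> k z z > 0" using ip_pos assms z by blast
    have "f (mul \<gamma> k z (cj k z)) = 0" using star_homD(4)[OF assms(1)] z by simp
    moreover have "mul \<gamma> k z (cj k z) = ip \<gamma> k z z *\<^sub>R e0" using mul_cj_self z by (simp add: rl_linear)
    ultimately have "ip \<gamma> k z z *\<^sub>R e0 = 0" using L(3)[of e0] star_homD(2)[OF assms(1)] by simp
    then show False using p by simp
  qed
  fix x y assume "x \<in> S k" "y \<in> S k" "f x = f y"
  then show "x = y" using *[of "x - y"] L(6)[of x y] by simp
qed


section \<open>Quaternions in the kernel of a derivation\<close>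

lemma up_eq_0_iff [simp]: "up r x = 0 \<longleftrightarrow> x = 0"
  using up_eq_iff[of r x 0] by simp

text \<open>On \<open>x\<close> and \<open>y\<close> the map \<open>a\<close> squares to -1, so on
  their product only the eigenvalues 0, 2i and -2i can occur, in the form
  \<open>a (a (a w)) = - (4 *\<^sub>R a w)\<close>. The hypothesis \<open>cube\<close> leaves only
  0.\<close>

lemma derivation_pair_product:
  assumes D: "der \<gamma> k a" and x: "x \<in> S k" "y \<in> S k" "a (a x) = - x" "a (a y) = - y"
    and cube: "\<And>z. z \<in> S k \<Longrightarrow> a (a (a z)) = - a z"
  shows "a (mul \<gamma> k x y) = 0"
proof -
  note L = linD[OF derD(1)[OF D]] and leib = derD(2)[OF D]
  let ?w = "mul \<gamma> k x y" and ?w' = "mul \<gamma> k (a x) (a y)"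
  have 1: "a ?w = mul \<gamma> k (a x) y + mul \<gamma> k x (a y)" using leib x by simp
  have 2: "a ?w' = - a ?w" using leib[of "a x" "a y"] 1 x L by simp
  have 3: "a (a ?w) = - (2 *\<^sub>R ?w) + 2 *\<^sub>R ?w'"
    unfolding 1 using x L by (simp add: leib scaleR_2 algebra_simps)
  have "a (a (a ?w)) = - (4 *\<^sub>R a ?w)"
    unfolding 3 using x L 2 by (simp add: vec_eq_iff)
  then have "4 *\<^sub>R a ?w = 1 *\<^sub>R a ?w" using cube[of ?w] x by simp
  then have "(4 - 1) *\<^sub>R a ?w = 0" unfolding scaleR_left_diff_distrib by simp
  then show ?thesis by simp
qed

text \<open>If \<open>x\<close> has nonzero norm and \<open>a (a x) = - x\<close>, then \<open>(a x) x\<close> and \<open>(b x) x\<close> lie in the kernel of \<open>a\<close>,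
  anticommute, and square to the same negative real number.\<close>

lemma quaternions_in_kernel:
  assumes \<gamma>: "\<And>i. i < 3 \<Longrightarrow> \<gamma> i \<noteq> 0" and \<delta>: "\<delta> 0 = - 1" "\<delta> 1 = - 1"
    and a: "der \<gamma> 3 a" and b: "der \<gamma> 3 b"
    and cube: "\<And>x. x \<in> S 3 \<Longrightarrow> a (a (a x)) = - a x"
    and sq: "\<And>x. x \<in> S 3 \<Longrightarrow> b (b x) = a (a x)"
    and ac: "\<And>x. x \<in> S 3 \<Longrightarrow> a (b x) = - b (a x)"
    and nz: "x0 \<in> S 3" "a x0 \<noteq> 0"
  obtains f where "star_hom \<delta> 2 \<gamma> 3 f" "inj_on f (S 2)" "\<And>x. x \<in> S 2 \<Longrightarrow> a (f x) = 0"
proof -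
  let ?m = "mul \<gamma> 3" and ?i = "ip \<gamma> 3"
  note La = linD[OF derD(1)[OF a]] and Lb = linD[OF derD(1)[OF b]]
  \<comment> \<open>Otherwise the space where \<open>a\<close> squares to -1 is totally isotropic.
    By skewness \<open>a x0\<close> is then orthogonal to everything, against nondegeneracy.\<close>
  have "\<exists>x\<in>S 3. a (a x) = - x \<and> ?i x x \<noteq> 0"
  proof (rule ccontr)
    assume "\<not> ?thesis"
    then have null: "?i x x = 0" if "x \<in> S 3" "a (a x) = - x" for x using that by blast
    let ?z = "a x0"
    have z: "?z \<in> S 3" "a (a ?z) = - ?z" using cube nz La by auto
    have "?i ?z y = 0" if y: "y \<in> S 3" for y
    proof -
      let ?w = "a (a y)"
      have w: "?w \<in> S 3" "a (a ?w) = - ?w" using y La cube by auto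
      have "?i (?z + ?w) (?z + ?w) = 0" "?i ?z ?z = 0" "?i ?w ?w = 0"
        using z w La by (intro null; simp)+
      then have "?i ?z ?w = 0" by (simp add: ip_commute[of \<gamma> 3 ?w ?z])
      moreover have "?i ?z ?w = ?i (a (a ?z)) y"
        using der_skew[OF a z(1) La(1)[OF y]] der_skew[OF a La(1)[OF z(1)] y] by linarith
      ultimately show ?thesis using z by simp
    qed
    then have "?z = 0" using ip_nondegenerate[of ?z 3 \<gamma>] z \<gamma> by blast
    then show False using nz by simp
  qed
  then obtain x where x: "x \<in> S 3" "a (a x) = - x" "?i x x \<noteq> 0" by blast
  define n where "n = ?i x x"
  define u where "u = a x"
  define v where "v = b x"
  have u: "u \<in> S 3" "cj 3 u = - u" and v: "v \<in> S 3" "cj 3 v = - v"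
    using x La Lb der_imaginary(1)[OF a x(1)] der_imaginary(1)[OF b x(1)] by (auto simp: u_def v_def)
  have "- cj 3 x = x" using der_imaginary(1)[OF a, of "a x"] x La by auto
  then have cx: "cj 3 x = - x" by (metis minus_minus)
  have xu: "?i x u = 0" "?i x v = 0"
    using der_imaginary(2)[OF a x(1)] der_imaginary(2)[OF b x(1)] by (auto simp: u_def v_def)
  have uu: "?i u u = n" "?i v v = n"
    using der_skew[OF a x(1) u(1)] der_skew[OF b x(1) v(1)] x sq by (auto simp: u_def v_def n_def)
  have "?i u v = - ?i x (a (b x))" "?i v u = - ?i x (b (a x))"
    using der_skew[OF a x(1) v(1)] der_skew[OF b x(1) u(1)] by (auto simp: u_def v_def)
  then have uv: "?i u v = 0" using ac[OF x(1)] ip_commute[of \<gamma> 3 u v] by simp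
  have zu: "a (a u) = - u" and zv: "a (a v) = - v"
    using cube[OF x(1)] ac x(1,2) Lb ac[of "a x"] La by (auto simp: u_def v_def)
  \<comment> \<open>The factor gives norm 1, since norms multiply and \<open>x\<close>,
    \<open>u\<close> and \<open>v\<close> all have norm \<open>n\<close>.\<close>
  define I where "I = (1 / n) *\<^sub>R ?m u x"
  define J where "J = (1 / n) *\<^sub>R ?m v x"
  define K where "K = ?m I J"
  have ker: "a (?m u x) = 0" "a (?m v x) = 0"
    using derivation_pair_product[OF a] u v x zu zv cube by auto
  have S: "I \<in> S 3" "J \<in> S 3" "K \<in> S 3" using u v x by (auto simp: I_def J_def K_def)
  have k: "a I = 0" "a J = 0" "a K = 0"
  proof -
    show 1: "a I = 0" "a J = 0" using ker u v x La by (simp_all add: I_def J_def)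
    show "a K = 0" using derD(2)[OF a S(1,2)] 1 by (simp add: K_def)
  qed
  have cI: "cj 3 I = - I" "cj 3 J = - J"
  proof -
    have "?m x u + ?m u x = 0" "?m x v + ?m v x = 0"
      using imaginary_anticommute[OF x(1) u(1) cx u(2), of \<gamma>]
        imaginary_anticommute[OF x(1) v(1) cx v(2), of \<gamma>] xu by auto
    then have "?m x u = - ?m u x" "?m x v = - ?m v x" by (simp_all add: eq_neg_iff_add_eq_0)
    then show "cj 3 I = - I" "cj 3 J = - J" using cx u(2) v(2) by (simp_all add: I_def J_def cj_mul)
  qed
  have nn: "n \<noteq> 0" using x by (simp add: n_def)
  have nI: "?i I I = 1" "?i J J = 1" "?i I J = 0"
    using nn uu uv u v x ip_mul_left_3[of x u u \<gamma>] ip_mul_left_3[of x v v \<gamma>] ip_mul_left_3[of x u v \<gamma>]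
    by (simp_all add: I_def J_def n_def[symmetric] field_simps)
  have II: "?m I I = - e0" "?m J J = - e0"
    using mul_cj_self(1)[OF S(1), of \<gamma>] mul_cj_self(1)[OF S(2), of \<gamma>] cI nI
    by (auto simp: minus_equation_iff)
  have JI: "?m J I = - K"
    using imaginary_anticommute[OF S(1,2) cI, of \<gamma>] nI by (simp add: K_def eq_neg_iff_add_eq_0 add.commute)
  have cK: "cj 3 K = - K" using cI JI by (simp add: K_def cj_mul)
  have "?i K K = 1" using ip_mul_3[OF S(1,2), of \<gamma>] nI by (simp add: K_def)
  then have KK: "?m K K = - e0" using mul_cj_self(1)[OF S(3), of \<gamma>] cK by (auto simp: minus_equation_iff)
  \<comment> \<open>Octonions are not associative, so the products with \<open>K\<close> come from
    the cancellation rules for conjugates.\<close>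
  have "- ?m I K = J" and "- ?m K J = I"
    using mul_cj_cancel_3(1)[OF S(1) S(2), of \<gamma>] mul_cj_cancel_3(2)[OF S(2) S(1), of \<gamma>] cI nI \<gamma>
    by (simp_all add: K_def)
  then have IK: "?m I K = - J" and KJ: "?m K J = - I" by (metis minus_minus)+
  have JK: "?m J K = I" and KI: "?m K I = J"
  proof -
    have K': "K = - ?m J I" using JI by simp
    show "?m J K = I" "?m K I = J" unfolding K'
      using mul_cj_cancel_3[OF S(1) S(2), of \<gamma>] mul_cj_cancel_3[OF S(2) S(1), of \<gamma>] cI nI \<gamma> by auto
  qed
  \<comment> \<open>The four real entries of a pair of depth two are the coordinates with respect to
    1, i, j, k.\<close>
  define f where "f y = cf (p1 (p1 y)) 0 *\<^sub>R e0 + cf (p2 (p1 y)) 0 *\<^sub>R I + cf (p1 (p2 y)) 0 *\<^sub>R J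
      + cf (p2 (p2 y)) 0 *\<^sub>R K" for y
  have f: "f (pair (pair (rl p) (rl q)) (pair (rl r) (rl s))) = p *\<^sub>R e0 + q *\<^sub>R I + r *\<^sub>R J + s *\<^sub>R K"
    for p q r s by (simp add: f_def)
  have "lin 2 3 f" unfolding lin_def f_def using S by (auto simp: algebra_simps)
  moreover have "f e0 = e0" by (simp add: f_def)
  moreover have "f (cj 2 y) = cj 3 (f y)" if "y \<in> S 2" for y
  proof -
    have cj2: "cj 2 (pair (pair (rl p) (rl q)) (pair (rl r) (rl s)))
        = pair (pair (rl p) (rl (- q))) (pair (rl (- r)) (rl (- s)))" for p q r s
      by (simp add: numeral_2_eq_2 pair_minus rl_linear)
    show ?thesis by (rule S_2E[OF that]) (simp add: f cj2 cI cK)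
  qed
  moreover have "f (mul \<delta> 2 y z) = ?m (f y) (f z)" if yz: "y \<in> S 2" "z \<in> S 2" for y z
  proof -
    obtain p q r s where y: "y = pair (pair (rl p) (rl q)) (pair (rl r) (rl s))" using S_2E yz(1) .
    obtain e g h t where z: "z = pair (pair (rl e) (rl g)) (pair (rl h) (rl t))" using S_2E yz(2) .
    show ?thesis unfolding y z mul_2 f using S \<delta>
      by (simp add: mul_distrib II JI KK IK KJ JK KI K_def[symmetric])
        (simp add: vec_eq_iff algebra_simps)
  qed
  ultimately have sh: "star_hom \<delta> 2 \<gamma> 3 f" by (simp add: star_hom_def)
  moreover have "inj_on f (S 2)"
    by (rule star_hom_inj_of_definite[OF sh]) (use \<delta> in \<open>auto simp: less_2_cases_iff\<close>)
  moreover have "a (f y) = 0" if "y \<in> S 2" for y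
    using S k La a by (simp add: f_def)
  ultimately show ?thesis using that by blast
qed

section \<open>Injective linear maps from a level to itself are surjective\<close>

primrec proj :: "nat \<Rightarrow> vec \<Rightarrow> vec" where
  "proj 0 x = rl (cf x 0)"
| "proj (Suc k) x = pair (proj k (p1 x)) (proj k (p2 x))"

lemma linear_proj: "linear (proj k)"
proof -
  have "proj k (x + y) = proj k x + proj k y \<and> proj k (r *\<^sub>R x) = r *\<^sub>R proj k x" for x y r
    by (induction k arbitrary: x y) (simp_all add: pair_add pair_scaleR rl_linear)
  then show ?thesis by (auto intro: linearI)
qed

lemma proj_in_S [simp]: "proj k x \<in> S k"
  by (induction k arbitrary: x) (simp_all add: S.simps(1))

lemma proj_eq: "x \<in> S k \<Longrightarrow> proj k x = x"
  by (induction k arbitrary: x) (auto simp: S.simps)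

lemma S_finite_spanning: "\<exists>B. finite B \<and> S k \<subseteq> span B"
proof (induction k)
  case 0
  have "rl r \<in> span {e0}" for r
  proof -
    have "rl r = r *\<^sub>R e0" by (simp add: rl_linear)
    then show ?thesis by (metis insertI1 span_base span_scale)
  qed
  then have "S 0 \<subseteq> span {e0}" by (auto simp: S.simps)
  then show ?case by (intro exI[of _ "{e0}"]) simp
next
  case (Suc k)
  then obtain B where B: "finite B" "S k \<subseteq> span B" by blast
  let ?B = "(\<lambda>b. pair b 0) ` B \<union> pair 0 ` B"
  have lins: "linear (\<lambda>b. pair b 0)" "linear (pair 0)"
    by (auto intro!: linearI simp: pair_add pair_scaleR)
  have "pair a b \<in> span ?B" if "a \<in> S k" "b \<in> S k" for a b
  proof -
    have "pair a 0 \<in> span ((\<lambda>b. pair b 0) ` B)" "pair 0 b \<in> span (pair 0 ` B)"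
      using that B lins by (auto simp: linear_span_image)
    then have "pair a 0 + pair 0 b \<in> span ?B"
      by (meson Un_upper1 Un_upper2 span_add span_mono subsetD)
    then show ?thesis by (simp add: pair_add)
  qed
  then have "S (Suc k) \<subseteq> span ?B" by (auto elim: S_SucE)
  then show ?case using B by (intro exI[of _ ?B]) simp
qed

lemma lin_inj_surj:
  assumes f: "lin k k f" "inj_on f (S k)"
  shows "f ` S k = S k"
proof
  note L = linD[OF f(1)]
  show "f ` S k \<subseteq> S k" using L by auto
  obtain B0 where B0: "finite B0" "S k \<subseteq> span B0" using S_finite_spanning by blast
  obtain B where B: "B \<subseteq> S k" "independent B" "S k \<subseteq> span B"
    using maximal_independent_subset by blast
  have sB: "span B = S k" using B subspace_S span_minimal by blast
  have finB: "finite B" using independent_span_bound[of B0 B] B B0 by auto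
  \<comment> \<open>\<open>f\<close> is linear on \<open>S k\<close> only; composing with the
    projection gives a map that is linear on the whole type, to which the facts on spans and
    independence apply.\<close>
  let ?g = "\<lambda>x. f (proj k x)"
  have g: "linear ?g"
    using linear_add[OF linear_proj] linear_scale[OF linear_proj] L by (intro linearI) auto
  have geq: "?g x = f x" if "x \<in> S k" for x using that by (simp add: proj_eq)
  have injg: "inj_on ?g (span B)" using f(2) by (simp add: sB inj_on_def proj_eq)
  have ind: "independent (?g ` B)"
    using linear_independent_injective_image[OF g B(2) injg] .
  have gS: "?g ` B \<subseteq> S k" using L by auto
  have card: "card (?g ` B) = card B" using injg span_superset by (metis card_image inj_on_subset)
  show "S k \<subseteq> f ` S k"
  proof
    fix y assume y: "y \<in> S k"
    have "y \<in> span (?g ` B)"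
    proof (rule ccontr)
      assume n: "y \<notin> span (?g ` B)"
      then have "independent (insert y (?g ` B))" using ind by (simp add: independent_insert)
      moreover have "insert y (?g ` B) \<subseteq> span B" using y gS sB by auto
      ultimately have "card (insert y (?g ` B)) \<le> card B" using independent_span_bound finB by blast
      moreover have "y \<notin> ?g ` B" by (rule contra_subsetD[OF span_superset n])
      then have "card (insert y (?g ` B)) = Suc (card B)"
        unfolding card[symmetric] by (rule card_insert_disjoint[OF finite_imageI[OF finB]])
      ultimately show False by linarith
    qed
    then have "y \<in> ?g ` span B" using linear_span_image[OF g] by blast
    then show "y \<in> f ` S k" using geq by (auto simp: sB proj_eq)
  qed
qed

section \<open>Derivations given by left multiplication on the second component\<close>

definition left_der :: "(nat \<Rightarrow> real) \<Rightarrow> vec \<Rightarrow> vec \<Rightarrow> vec" where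
  "left_der \<gamma> c x = pair 0 (mul \<gamma> 2 c (p2 x))"

lemma left_der_pair [simp]: "left_der \<gamma> c (pair a b) = pair 0 (mul \<gamma> 2 c b)"
  by (simp add: left_der_def)

lemma left_der_0 [simp]: "left_der \<gamma> c 0 = 0"
  by (simp add: left_der_def)

lemma S_3E:
  assumes "x \<in> S 3"
  obtains a b where "x = pair a b" "a \<in> S 2" "b \<in> S 2"
  using assms by (metis S_SucE eval_nat_numeral(3))

text \<open>In the first component of a product the two contributions to the Leibniz rule cancel,
  because \<open>c\<close> is imaginary and quaternions associate; in the second component the rule
  is associativity.\<close>

lemma left_der:
  assumes c: "c \<in> S 2" "cj 2 c = - c"
  shows "der \<gamma> 3 (left_der \<gamma> c)" "x \<in> S 3 \<Longrightarrow> left_der \<gamma> c (cj 3 x) = cj 3 (left_der \<gamma> c x)"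
proof -
  have "left_der \<gamma> c (mul \<gamma> 3 x y) = mul \<gamma> 3 (left_der \<gamma> c x) y + mul \<gamma> 3 x (left_der \<gamma> c y)"
    if xy: "x \<in> S 3" "y \<in> S 3" for x y
  proof -
    obtain a b where x: "x = pair a b" "a \<in> S 2" "b \<in> S 2" using xy S_3E by blast
    obtain d e where y: "y = pair d e" "d \<in> S 2" "e \<in> S 2" using xy S_3E by blast
    have "mul \<gamma> 2 (mul \<gamma> 2 (cj 2 e) c) b = mul \<gamma> 2 (cj 2 e) (mul \<gamma> 2 c b)"
      using x y c by (simp add: mul_2_assoc)
    then show ?thesis unfolding x y using x y c
      by (simp add: pair_add cj_mul mul_distrib mul_2_assoc)
  qed
  moreover have "lin 3 3 (left_der \<gamma> c)"
    unfolding lin_def using c by (auto elim!: S_3E simp: mul_distrib pair_add pair_scaleR)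
  ultimately show "der \<gamma> 3 (left_der \<gamma> c)" by (simp add: der_def)
  show "x \<in> S 3 \<Longrightarrow> left_der \<gamma> c (cj 3 x) = cj 3 (left_der \<gamma> c x)"
    by (auto elim!: S_3E simp: pair_minus)
qed

lemma left_der_left_der:
  assumes "x \<in> S 3" "c \<in> S 2" "d \<in> S 2"
  shows "left_der \<gamma> c (left_der \<gamma> d x) = left_der \<gamma> (mul \<gamma> 2 c d) x"
  using assms(1) by (rule S_3E) (simp add: assms mul_2_assoc)

text \<open>Since \<open>c\<close> squares to a nonzero real, left multiplication by
  \<open>c\<close> is injective on quaternions, so every octonion entry has second component
  zero.\<close>

lemma lift_left_der_kernel:
  assumes c: "c \<in> S 2" "mul \<gamma> 2 c c = rl t" "t \<noteq> 0"
    and x: "x \<in> S (3 + r)" "lift r (left_der \<gamma> c) x = 0"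
  shows "\<exists>y\<in>S (2 + r). x = lift r (\<lambda>a. pair a 0) y"
  using x
proof (induction r arbitrary: x)
  case 0
  then obtain a b where x: "x = pair a b" "a \<in> S 2" "b \<in> S 2" using S_3E by auto
  have "mul \<gamma> 2 c b = 0" using 0 x by simp
  then have "mul \<gamma> 2 (mul \<gamma> 2 c c) b = 0" using mul_2_assoc[OF c(1) c(1) x(3)] by simp
  then have "b = 0" using c x by simp
  then show ?case using x by auto
next
  case (Suc r)
  obtain a b where x: "x = pair a b" "a \<in> S (3 + r)" "b \<in> S (3 + r)"
    using S_SucE[OF Suc.prems(1)[unfolded add_Suc_right]] .
  then obtain y z where "y \<in> S (2 + r)" "a = lift r (\<lambda>a. pair a 0) y" "z \<in> S (2 + r)" "b = lift r (\<lambda>a. pair a 0) z"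
    using Suc.IH[of a] Suc.IH[of b] Suc.prems by auto
  then show ?case using x by (intro bexI[of _ "pair y z"]) auto
qed

text \<open>The kernel of a lifted derivation \<open>left_der\<close> is the Cayley-Dickson algebra built with the remaining
  parameters over the quaternions instead of the octonions.\<close>

lemma alg_iso_delete_third:
  assumes \<gamma>: "\<And>i. i < 3 + r \<Longrightarrow> \<gamma> i \<noteq> 0" "\<gamma> 0 = - 1" "\<gamma> 1 = - 1"
    and \<delta>: "\<And>i. i < 3 + r \<Longrightarrow> \<delta> i \<noteq> 0" and h: "alg_iso \<gamma> \<delta> (3 + r) h"
    and \<gamma>': "\<gamma>' = (\<lambda>s. if s < 2 then - 1 else \<gamma> (Suc s))"
    and \<delta>': "\<delta>' = (\<lambda>s. if s < 2 then - 1 else \<delta> (Suc s))"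
  obtains \<theta> where "alg_iso \<delta>' \<gamma>' (2 + r) \<theta>"
proof -
  let ?i = "ii 2" and ?j = "jj 2"
  have ij: "mul \<gamma> 2 ?i ?i = - e0" "mul \<gamma> 2 ?j ?j = - e0" "mul \<gamma> 2 ?j ?i = - mul \<gamma> 2 ?i ?j"
    using mul_ii_ii[of 2 e0 \<gamma>] mul_jj_jj(1)[of 2 e0 \<gamma>] mul_jj_ii[of 2 \<gamma>] \<gamma> by auto
  have neg: "left_der \<gamma> (- c) x = - left_der \<gamma> c x" "left_der \<gamma> c (- x) = - left_der \<gamma> c x" for c x
    by (simp_all add: left_der_def pair_minus)
  have e0: "left_der \<gamma> e0 (left_der \<gamma> c x) = left_der \<gamma> c x" if "x \<in> S 3" "c \<in> S 2" for c x
    using that by (simp add: left_der_left_der)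
  let ?A = "lift r (left_der \<gamma> ?i)" and ?B = "lift r (left_der \<gamma> ?j)"
  have der: "der \<gamma> (3 + r) ?A" "der \<gamma> (3 + r) ?B"
    using lift_der[of \<gamma> 3 "left_der \<gamma> ?i" r] lift_der[of \<gamma> 3 "left_der \<gamma> ?j" r] left_der
    by auto
  have A3: "?A (?A (?A x)) = - ?A x" if "x \<in> S (3 + r)" for x
    unfolding lift_lift lift_minus[symmetric] using that
    by (intro lift_cong[of 3]) (simp_all add: left_der_left_der ij neg e0)
  have A2: "?B (?B x) = ?A (?A x)" if "x \<in> S (3 + r)" for x
    unfolding lift_lift using that
    by (intro lift_cong[of 3]) (simp_all add: left_der_left_der ij)
  have AB: "?A (?B x) = - ?B (?A x)" if "x \<in> S (3 + r)" for x
    unfolding lift_lift lift_minus[symmetric] using that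
    by (intro lift_cong[of 3]) (simp_all add: left_der_left_der ij neg)
  \<comment> \<open>The derivations carried over by \<open>h\<close> are again entrywise extensions
    of octonion derivations, called \<open>a\<close> and \<open>b\<close>.\<close>
  obtain A' where A': "der \<delta> (3 + r) A'" "\<And>x. x \<in> S (3 + r) \<Longrightarrow> A' (h x) = h (?A x)"
    using transport_der[OF h der(1)] by blast
  obtain B' where B': "der \<delta> (3 + r) B'" "\<And>x. x \<in> S (3 + r) \<Longrightarrow> B' (h x) = h (?B x)"
    using transport_der[OF h der(2)] by blast
  obtain a where a: "der \<delta> 3 a" "\<And>x. x \<in> S (3 + r) \<Longrightarrow> A' x = lift r a x"
    using der_lift_octonion[OF \<delta> A'(1)] by blast
  obtain b where b: "der \<delta> 3 b" "\<And>x. x \<in> S (3 + r) \<Longrightarrow> B' x = lift r b x"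
    using der_lift_octonion[OF \<delta> B'(1)] by blast
  note Lh = linD[OF alg_isoD(1)[OF h]] and LA = linD[OF derD(1)[OF der(1)]]
    and LB = linD[OF derD(1)[OF der(2)]] and La = linD[OF derD(1)[OF a(1)]] and Lb = linD[OF derD(1)[OF b(1)]]
  have hS: "\<exists>z\<in>S (3 + r). x = h z" if "x \<in> S (3 + r)" for x
    using alg_isoD(2)[OF h] that by (auto simp: bij_betw_def)
  have la: "lift r a (h x) = h (?A x)" and lb: "lift r b (h x) = h (?B x)" if "x \<in> S (3 + r)" for x
    using that A' B' a b Lh by auto
  have upa: "lift r a (up r x) = up r (a x)" "lift r b (up r x) = up r (b x)" for x
    using La Lb by (simp_all add: lift_up)
  \<comment> \<open>The relations between \<open>?A\<close> and \<open>?B\<close> pass through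
    \<open>h\<close> and are read off in the first entry, via \<open>up r x\<close>.\<close>
  have rel: "a (a (a x)) = - a x" "b (b x) = a (a x)" "a (b x) = - b (a x)" if x: "x \<in> S 3" for x
  proof -
    obtain z where z: "z \<in> S (3 + r)" "up r x = h z" using hS[OF up_in_S[OF x]] by blast
    have "up r (a (a (a x))) = up r (- a x)" "up r (b (b x)) = up r (a (a x))" "up r (a (b x)) = up r (- b (a x))"
      unfolding up_linear upa[symmetric] z(2) using z(1) by (simp_all add: la lb LA LB A2 A3 AB Lh)
    then show "a (a (a x)) = - a x" "b (b x) = a (a x)" "a (b x) = - b (a x)" by simp_all
  qed
  have "\<exists>x\<in>S 3. a x \<noteq> 0"
  proof (rule ccontr)
    assume "\<not> ?thesis"
    then have "lift r a x = 0" if "x \<in> S (3 + r)" for x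
      using lift_cong[of 3 a "\<lambda>x. 0" x r] that by (simp add: lift_zero)
    moreover have l: "pair 0 e0 \<in> S 3" by (simp add: eval_nat_numeral)
    ultimately have "h (?A (up r (pair 0 e0))) = h 0" using la[of "up r (pair 0 e0)"] Lh by simp
    then have "?A (up r (pair 0 e0)) = 0"
      using alg_isoD(3)[OF h] l by (meson LA(1) inj_onD up_in_S zero_in_S)
    then have "up r (left_der \<gamma> ?i (pair 0 e0)) = up r 0" by (simp add: lift_up)
    then have "?i = 0" by simp
    then show False using ij by simp
  qed
  then obtain x0 where x0: "x0 \<in> S 3" "a x0 \<noteq> 0" by blast
  obtain f where f: "star_hom \<delta>' 2 \<delta> 3 f" "inj_on f (S 2)" "\<And>x. x \<in> S 2 \<Longrightarrow> a (f x) = 0"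
    using quaternions_in_kernel[of \<delta> \<delta>' a b x0] \<delta> a(1) b(1) rel x0 by (auto simp: \<delta>')
  \<comment> \<open>\<open>F\<close> embeds the algebra with parameters \<open>\<delta>'\<close>
    through the quaternions found in the kernel of \<open>a\<close>, and \<open>G\<close> embeds the
    one with parameters \<open>\<gamma>'\<close> through the standard quaternions.\<close>
  define F where "F = lift r f"
  define G where "G = lift r (\<lambda>a. pair a 0)"
  have F: "star_hom \<delta>' (2 + r) \<delta> (3 + r) F" unfolding F_def by (rule lift_star_hom[OF f(1)]) (simp add: \<delta>' numeral_3_eq_3)
  have "star_hom \<gamma>' 2 \<gamma> 3 (\<lambda>a. pair a 0)"
  proof -
    have "mul \<gamma>' 2 x y = mul \<gamma> 2 x y" if xy: "x \<in> S 2" "y \<in> S 2" for x y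
    proof -
      obtain p q s t where x: "x = pair (pair (rl p) (rl q)) (pair (rl s) (rl t))" using S_2E xy(1) .
      obtain e g k l where y: "y = pair (pair (rl e) (rl g)) (pair (rl k) (rl l))" using S_2E xy(2) .
      show ?thesis using \<gamma>(2,3) unfolding x y mul_2 by (simp add: \<gamma>')
    qed
    then show ?thesis unfolding star_hom_def lin_def by (simp add: pair_add pair_scaleR pair_rl_0)
  qed
  then have G: "star_hom \<gamma>' (2 + r) \<gamma> (3 + r) G" unfolding G_def by (rule lift_star_hom) (simp add: \<gamma>' numeral_3_eq_3)
  have injF: "inj_on F (S (2 + r))" unfolding F_def by (rule lift_inj_on[OF f(2)])
  have injG: "inj_on G (S (2 + r))" unfolding G_def by (rule lift_inj_on) (simp add: inj_on_def)
  note LF = linD[OF star_homD(1)[OF F]] and LG = linD[OF star_homD(1)[OF G]]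
  \<comment> \<open>\<open>lift r a\<close> kills the image of \<open>F\<close>, so the preimage
    under \<open>h\<close> lies in the kernel of \<open>?A\<close>, which consists of values of
    \<open>G\<close>. The map \<theta> is \<open>F\<close> followed by the inverses of
    \<open>h\<close> and \<open>G\<close>.\<close>
  have "\<exists>y\<in>S (2 + r). F x = h (G y)" if x: "x \<in> S (2 + r)" for x
  proof -
    obtain z where z: "z \<in> S (3 + r)" "F x = h z" using hS[OF LF(1)[OF x]] by blast
    have "h (?A z) = lift r (\<lambda>x. a (f x)) x"
      unfolding la[OF z(1), symmetric] z(2)[symmetric] F_def by (rule lift_lift)
    also have "\<dots> = lift r (\<lambda>x. 0) x" by (rule lift_cong[OF f(3) x])
    finally have "h (?A z) = h 0" using Lh(5) by (simp add: lift_zero)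
    then have "?A z = 0" by (rule inj_onD[OF alg_isoD(3)[OF h] _ LA(1)[OF z(1)] zero_in_S])
    then obtain y where "y \<in> S (2 + r)" "z = G y"
      using lift_left_der_kernel[OF ii_in_S _ _ z(1), of \<gamma> "- 1"] ij(1)
      by (auto simp: G_def rl_linear)
    then show ?thesis using z(2) by blast
  qed
  then have "\<forall>x\<in>S (2 + r). \<exists>y. y \<in> S (2 + r) \<and> F x = h (G y)" by blast
  from bchoice[OF this] obtain \<theta>
    where \<theta>: "\<And>x. x \<in> S (2 + r) \<Longrightarrow> \<theta> x \<in> S (2 + r)" "\<And>x. x \<in> S (2 + r) \<Longrightarrow> h (G (\<theta> x)) = F x"
    by force
  have inj: "x = y" if "h (G x) = h (G y)" "x \<in> S (2 + r)" "y \<in> S (2 + r)" for x y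
    using inj_onD[OF injG inj_onD[OF alg_isoD(3)[OF h] that(1)]] that(2,3) LG(1) by simp
  have eq: "\<theta> x = y" if "x \<in> S (2 + r)" "y \<in> S (2 + r)" "F x = h (G y)" for x y
    using inj[of "\<theta> x" y] \<theta>[of x] that by simp
  have lin: "lin (2 + r) (2 + r) \<theta>" unfolding lin_def
  proof (intro conjI ballI allI)
    fix x y r' assume xy: "x \<in> S (2 + r)" "y \<in> S (2 + r)"
    show "\<theta> x \<in> S (2 + r)" using \<theta> xy by simp
    note t = \<theta>(1)[OF xy(1)] \<theta>(1)[OF xy(2)]
    show "\<theta> (x + y) = \<theta> x + \<theta> y"
      by (rule eq[OF S_closed(1)[OF xy] S_closed(1)[OF t]])
        (simp only: LF(2)[OF xy] LG(2)[OF t] Lh(2)[OF LG(1)[OF t(1)] LG(1)[OF t(2)]] \<theta>(2) xy)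
    show "\<theta> (r' *\<^sub>R x) = r' *\<^sub>R \<theta> x"
      by (rule eq[OF S_closed(4)[OF xy(1)] S_closed(4)[OF t(1)]])
        (simp only: LF(3)[OF xy(1)] LG(3)[OF t(1)] Lh(3)[OF LG(1)[OF t(1)]] \<theta>(2) xy)
  qed
  have "inj_on \<theta> (S (2 + r))"
  proof (rule inj_onI)
    fix x y assume xy: "x \<in> S (2 + r)" "y \<in> S (2 + r)" "\<theta> x = \<theta> y"
    then have "F x = F y" using \<theta>(2)[of x] \<theta>(2)[of y] by simp
    then show "x = y" using inj_onD[OF injF] xy by simp
  qed
  then have "bij_betw \<theta> (S (2 + r)) (S (2 + r))" using lin_inj_surj[OF lin] by (simp add: bij_betw_def)
  moreover have "\<theta> (mul \<delta>' (2 + r) x y) = mul \<gamma>' (2 + r) (\<theta> x) (\<theta> y)"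
    if xy: "x \<in> S (2 + r)" "y \<in> S (2 + r)" for x y
  proof (rule eq)
    show "F (mul \<delta>' (2 + r) x y) = h (G (mul \<gamma>' (2 + r) (\<theta> x) (\<theta> y)))"
      unfolding star_homD(4)[OF F xy] star_homD(4)[OF G \<theta>(1)[OF xy(1)] \<theta>(1)[OF xy(2)]]
        alg_isoD(4)[OF h LG(1)[OF \<theta>(1)[OF xy(1)]] LG(1)[OF \<theta>(1)[OF xy(2)]]]
      by (simp only: \<theta>(2) xy)
  qed (use xy \<theta>(1) in \<open>auto simp del: add_2_eq_Suc\<close>)
  ultimately have "alg_iso \<delta>' \<gamma>' (2 + r) \<theta>" using lin by (simp add: alg_iso_def)
  then show ?thesis using that by blast
qed

text \<open>As \<open>ii 2\<close> squares to 1, the derivation \<open>?A\<close> equals its cube,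
  and so does its transport \<open>a\<close>. Skewness makes the norm of \<open>a (a x)\<close> the
  negative of the norm of \<open>a x\<close>, which is impossible for a definite form.\<close>

lemma definite_not_iso:
  assumes h: "alg_iso \<gamma> \<delta> (3 + r) h" and \<gamma>: "\<gamma> 0 = 1"
    and \<delta>: "\<And>i. i < 3 + r \<Longrightarrow> \<delta> i \<noteq> 0" "\<And>i. i < 3 \<Longrightarrow> \<delta> i = - 1"
  shows False
proof -
  let ?i = "ii 2"
  have ij: "mul \<gamma> 2 ?i ?i = e0" using mul_ii_ii[of 2 e0 \<gamma>] \<gamma> by auto
  let ?A = "lift r (left_der \<gamma> ?i)"
  have der: "der \<gamma> (3 + r) ?A" using lift_der[of \<gamma> 3 "left_der \<gamma> ?i" r] left_der by auto
  have e0: "left_der \<gamma> e0 (left_der \<gamma> c x) = left_der \<gamma> c x" if "x \<in> S 3" "c \<in> S 2" for c x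
    using that by (simp add: left_der_left_der)
  have A3: "?A (?A (?A x)) = ?A x" if "x \<in> S (3 + r)" for x
    unfolding lift_lift using that
    by (intro lift_cong[of 3]) (simp_all add: left_der_left_der ij e0)
  obtain A' where A': "der \<delta> (3 + r) A'" "\<And>x. x \<in> S (3 + r) \<Longrightarrow> A' (h x) = h (?A x)"
    using transport_der[OF h der(1)] by blast
  obtain a where a: "der \<delta> 3 a" "\<And>x. x \<in> S (3 + r) \<Longrightarrow> A' x = lift r a x"
    using der_lift_octonion[OF \<delta>(1) A'(1)] by blast
  note Lh = linD[OF alg_isoD(1)[OF h]] and LA = linD[OF derD(1)[OF der(1)]]
    and La = linD[OF derD(1)[OF a(1)]]
  have la: "lift r a (h x) = h (?A x)" if "x \<in> S (3 + r)" for x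
    using that A' a Lh by auto
  have "\<exists>x\<in>S 3. a x \<noteq> 0"
  proof (rule ccontr)
    assume "\<not> ?thesis"
    then have "lift r a x = 0" if "x \<in> S (3 + r)" for x
      using lift_cong[of 3 a "\<lambda>x. 0" x r] that by (simp add: lift_zero)
    moreover have l: "pair 0 e0 \<in> S 3" by (simp add: eval_nat_numeral)
    ultimately have "h (?A (up r (pair 0 e0))) = h 0" using la[of "up r (pair 0 e0)"] Lh by simp
    then have "?A (up r (pair 0 e0)) = 0"
      using alg_isoD(3)[OF h] l by (meson LA(1) inj_onD up_in_S zero_in_S)
    then have "up r (left_der \<gamma> ?i (pair 0 e0)) = up r 0" by (simp add: lift_up)
    then have "?i = 0" by simp
    then show False using ij by simp
  qed
  then obtain x where x: "x \<in> S 3" "a x \<noteq> 0" by blast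
  have "up r x \<in> h ` S (3 + r)" using alg_isoD(2)[OF h] x by (simp add: bij_betw_def)
  then obtain z where z: "z \<in> S (3 + r)" "up r x = h z" by blast
  have "up r (a (a (a x))) = up r (a x)"
    unfolding lift_up[of a, OF La(5), symmetric] z(2) using z(1) by (simp add: la LA A3)
  then have a3: "a (a (a x)) = a x" by simp
  have "ip \<delta> 3 (a (a x)) (a (a x)) = - ip \<delta> 3 (a x) (a x)"
    using der_skew[OF a(1), of "a x" "a (a x)"] x La a3 by simp
  moreover have "ip \<delta> 3 (a x) (a x) > 0" using ip_pos[of 3 \<delta> "a x"] \<delta> x La by simp
  moreover have "ip \<delta> 3 (a (a x)) (a (a x)) \<ge> 0"
    using ip_pos[of 3 \<delta> "a (a x)"] \<delta> x La by (cases "a (a x) = 0") auto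
  ultimately show False by simp
qed


section \<open>Classification of the parameters\<close>

text \<open>The set \<open>SB k\<close> is the standard basis together with its negatives.\<close>

primrec SB :: "nat \<Rightarrow> vec set" where
  "SB 0 = {e0, - e0}"
| "SB (Suc k) = {x. p1 x \<in> SB k \<and> p2 x = 0 \<or> p1 x = 0 \<and> p2 x \<in> SB k}"

declare SB.simps [simp del]

lemma SB_pair [simp]:
  "pair a b \<in> SB (Suc k) \<longleftrightarrow> a \<in> SB k \<and> b = 0 \<or> a = 0 \<and> b \<in> SB k"
  by (simp add: SB.simps)

lemma SB_minus [simp]: "- x \<in> SB k \<longleftrightarrow> x \<in> SB k"
proof (induction k arbitrary: x)
  case 0
  have "- x = e0 \<longleftrightarrow> x = - e0" by (metis minus_minus)
  then show ?case by (auto simp: SB.simps)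
qed (simp add: SB.simps)

text \<open>The isomorphisms that permute the standard basis up to signs. Respecting the conjugation
  makes them extend to further doublings.\<close>

definition signed_iso :: "nat \<Rightarrow> (nat \<Rightarrow> real) \<Rightarrow> (nat \<Rightarrow> real) \<Rightarrow> (vec \<Rightarrow> vec) \<Rightarrow> bool" where
  "signed_iso k \<gamma> \<delta> f \<longleftrightarrow> star_hom \<gamma> k \<delta> k f \<and> bij_betw f (S k) (S k) \<and> (\<forall>x\<in>S k. f x \<in> SB k \<longleftrightarrow> x \<in> SB k)"

lemma signed_isoD:
  assumes "signed_iso k \<gamma> \<delta> f"
  shows "star_hom \<gamma> k \<delta> k f" "bij_betw f (S k) (S k)" "x \<in> S k \<Longrightarrow> f x \<in> SB k \<longleftrightarrow> x \<in> SB k"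
  using assms by (auto simp: signed_iso_def)

lemma signed_iso_alg_iso: "signed_iso k \<gamma> \<delta> f \<Longrightarrow> alg_iso \<gamma> \<delta> k f"
  by (simp add: signed_iso_def alg_iso_def star_hom_def)

lemma signed_iso_trans:
  assumes "signed_iso k \<gamma> \<delta> f" "signed_iso k \<delta> \<epsilon> g"
  shows "signed_iso k \<gamma> \<epsilon> (\<lambda>x. g (f x))"
proof -
  note F = signed_isoD[OF assms(1)] and G = signed_isoD[OF assms(2)]
  have "bij_betw (g \<circ> f) (S k) (S k)" using F(2) G(2) by (rule bij_betw_trans)
  then show ?thesis using star_homD[OF F(1)] star_homD[OF G(1)] F(3) G(3) linD[OF star_homD(1)[OF F(1)]]
      linD[OF star_homD(1)[OF G(1)]]
    unfolding signed_iso_def star_hom_def lin_def by (simp add: comp_def)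
qed

lemma signed_iso_sym:
  assumes "signed_iso k \<gamma> \<delta> f"
  shows "signed_iso k \<delta> \<gamma> (inv_into (S k) f)"
proof -
  let ?g = "inv_into (S k) f"
  note F = signed_isoD[OF assms] and L = linD[OF star_homD(1)[OF signed_isoD(1)[OF assms]]]
  note I = alg_iso_sym[OF signed_iso_alg_iso[OF assms]]
  have inj: "inj_on f (S k)" using F(2) by (simp add: bij_betw_def)
  have g: "?g x \<in> S k" "f (?g x) = x" if "x \<in> S k" for x
    using that F(2) by (auto simp: bij_betw_def inv_into_into f_inv_into_f)
  have eq: "?g x = y" if "y \<in> S k" "f y = x" for x y
    using that inv_into_f_f[OF inj] by auto
  have "?g e0 = e0" using star_homD(2)[OF F(1)] by (intro eq) auto
  moreover have "?g (cj k x) = cj k (?g x)" if "x \<in> S k" for x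
    using that g by (intro eq) (auto simp: star_homD(3)[OF F(1)])
  moreover have "?g x \<in> SB k \<longleftrightarrow> x \<in> SB k" if "x \<in> S k" for x
    using F(3)[OF g(1)[OF that]] g(2)[OF that] by simp
  ultimately show ?thesis using I by (simp add: signed_iso_def star_hom_def alg_iso_def)
qed

lemma signed_iso_lift:
  assumes "signed_iso k \<gamma> \<delta> f" "\<And>s. s < r \<Longrightarrow> \<gamma> (k + s) = \<delta> (k + s)"
  shows "signed_iso (k + r) \<gamma> \<delta> (lift r f)"
proof -
  note F = signed_isoD[OF assms(1)]
  have sh: "star_hom \<gamma> (k + r) \<delta> (k + r) (lift r f)" using lift_star_hom[OF F(1)] assms(2) by blast
  have inj: "inj_on (lift r f) (S (k + r))" using lift_inj_on F(2) by (simp add: bij_betw_def)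
  \<comment> \<open>Membership of a pair in \<open>SB\<close> requires one component to be zero, so
    the induction carries the statement about zero along.\<close>
  have "(lift r f x \<in> SB (k + r) \<longleftrightarrow> x \<in> SB (k + r)) \<and> (lift r f x = 0 \<longleftrightarrow> x = 0)"
    if "x \<in> S (k + r)" for x
    using that
  proof (induction r arbitrary: x)
    case 0
    have "f x = 0 \<longleftrightarrow> x = 0"
      using 0 F(2) linD(5)[OF star_homD(1)[OF F(1)]] by (simp add: bij_betw_def) (metis inj_onD zero_in_S)
    then show ?case using F(3) 0 by simp
  next
    case (Suc r)
    obtain a b where x: "x = pair a b" "a \<in> S (k + r)" "b \<in> S (k + r)"
      using S_SucE[OF Suc.prems[unfolded add_Suc_right]] .
    show ?case using Suc.IH[OF x(2)] Suc.IH[OF x(3)] x(1) by simp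
  qed
  then show ?thesis using sh inj lin_inj_surj[OF star_homD(1)[OF sh] inj] by (simp add: signed_iso_def bij_betw_def)
qed

section \<open>Changes of generators that respect the signed basis\<close>

lemma mul_cong:
  assumes "\<And>i. i < k \<Longrightarrow> \<gamma> i = \<delta> i"
  shows "mul \<gamma> k = mul \<delta> k"
  using assms by (induction k) (auto simp: fun_eq_iff mul.simps)

lemma signed_iso_refl:
  assumes "\<And>i. i < k \<Longrightarrow> \<gamma> i = \<delta> i"
  shows "signed_iso k \<gamma> \<delta> (\<lambda>x. x)"
  using mul_cong[OF assms] by (simp add: signed_iso_def star_hom_def lin_def bij_betw_def)

text \<open>The generators of two consecutive doublings of a commutative level are adjoined in the
  opposite order. They anticommute, whence the minus sign at the coordinate of their
  product.\<close>

lemma signed_iso_swap: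
  assumes comm: "\<And>a b. a \<in> S k \<Longrightarrow> b \<in> S k \<Longrightarrow> mul \<gamma> k a b = mul \<gamma> k b a"
    and \<delta>: "\<And>i. i < k \<Longrightarrow> \<gamma> i = \<delta> i" "\<delta> k = \<gamma> (Suc k)" "\<delta> (Suc k) = \<gamma> k"
  shows "signed_iso (Suc (Suc k)) \<gamma> \<delta>
    (\<lambda>x. pair (pair (p1 (p1 x)) (p1 (p2 x))) (pair (p2 (p1 x)) (- p2 (p2 x))))" (is "signed_iso _ _ _ ?f")
proof -
  have cj_comm: "cj k (mul \<gamma> k a b) = mul \<gamma> k (cj k a) (cj k b)" if "a \<in> S k" "b \<in> S k" for a b
    using that by (simp add: cj_mul comm)
  have "lin (Suc (Suc k)) (Suc (Suc k)) ?f"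
    by (auto simp: lin_def S.simps pair_add pair_scaleR)
  moreover have "?f e0 = e0" by (simp add: pair_rl_0)
  moreover have "?f (cj (Suc (Suc k)) x) = cj (Suc (Suc k)) (?f x)" for x
    by (simp add: cj.simps pair_minus)
  moreover have "?f (mul \<gamma> (Suc (Suc k)) x y) = mul \<delta> (Suc (Suc k)) (?f x) (?f y)"
    if xy: "x \<in> S (Suc (Suc k))" "y \<in> S (Suc (Suc k))" for x y
  proof -
    obtain u v where x: "x = pair u v" "u \<in> S (Suc k)" "v \<in> S (Suc k)" using S_SucE[OF xy(1)] .
    obtain w z where y: "y = pair w z" "w \<in> S (Suc k)" "z \<in> S (Suc k)" using S_SucE[OF xy(2)] .
    obtain a b where u: "u = pair a b" "a \<in> S k" "b \<in> S k" using S_SucE[OF x(2)] .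
    obtain c d where v: "v = pair c d" "c \<in> S k" "d \<in> S k" using S_SucE[OF x(3)] .
    obtain e g where w: "w = pair e g" "e \<in> S k" "g \<in> S k" using S_SucE[OF y(2)] .
    obtain h l where z: "z = pair h l" "h \<in> S k" "l \<in> S k" using S_SucE[OF y(3)] .
    show ?thesis unfolding x(1) y(1) u(1) v(1) w(1) z(1)
      using u v w z
      by (simp add: mul_cong[OF \<delta>(1), symmetric] \<delta> pair_add pair_minus pair_scaleR cj_comm comm
          scaleR_add_right algebra_simps)
  qed
  moreover have "?f ` S (Suc (Suc k)) = S (Suc (Suc k)) \<and> inj_on ?f (S (Suc (Suc k)))"
  proof -
    have inj: "inj_on ?f (S (Suc (Suc k)))"
      by (rule inj_onI) (simp, metis pair_p1_p2)
    then show ?thesis using lin_inj_surj calculation(1) by blast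
  qed
  moreover have "?f x \<in> SB (Suc (Suc k)) \<longleftrightarrow> x \<in> SB (Suc (Suc k))" for x
  proof -
    have "x = pair (pair (p1 (p1 x)) (p2 (p1 x))) (pair (p1 (p2 x)) (p2 (p2 x)))" by simp
    then show ?thesis by (metis (no_types, lifting) SB_pair SB_minus neg_equal_0_iff_equal pair_eq_zero_iff)
  qed
  ultimately show ?thesis by (simp add: signed_iso_def star_hom_def bij_betw_def)
qed

text \<open>When i squares to 1, the elements j and ij have opposite squares and can exchange their
  roles as second generator.\<close>

lemma signed_iso_twist:
  assumes "\<gamma> 0 = 1" "\<delta> 0 = 1" "\<delta> 1 = - \<gamma> 1"
  shows "signed_iso 2 \<gamma> \<delta> (\<lambda>x. pair (p1 x) (pair (p2 (p2 x)) (p1 (p2 x))))" (is "signed_iso _ _ _ ?f")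
proof -
  have f: "?f (pair (pair (rl a) (rl b)) (pair (rl c) (rl d))) = pair (pair (rl a) (rl b)) (pair (rl d) (rl c))"
    for a b c d by simp
  have "lin 2 2 ?f"
    by (auto simp: lin_def numeral_2_eq_2 S.simps pair_add pair_scaleR)
  moreover have "?f e0 = e0" by (simp add: pair_rl_0)
  moreover have "?f (cj 2 x) = cj 2 (?f x)" for x
    by (simp add: cj.simps pair_minus numeral_2_eq_2)
  moreover have "?f (mul \<gamma> 2 x y) = mul \<delta> 2 (?f x) (?f y)" if xy: "x \<in> S 2" "y \<in> S 2" for x y
  proof -
    obtain a b c d where x: "x = pair (pair (rl a) (rl b)) (pair (rl c) (rl d))" using S_2E xy(1) .
    obtain e g h l where y: "y = pair (pair (rl e) (rl g)) (pair (rl h) (rl l))" using S_2E xy(2) .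
    show ?thesis unfolding x y mul_2 f using assms by (simp add: algebra_simps)
  qed
  moreover have "?f ` S 2 = S 2 \<and> inj_on ?f (S 2)"
  proof -
    have inj: "inj_on ?f (S 2)"
      by (rule inj_onI) (simp, metis pair_p1_p2)
    then show ?thesis using lin_inj_surj calculation(1) by blast
  qed
  moreover have "?f x \<in> SB 2 \<longleftrightarrow> x \<in> SB 2" for x
    by (auto simp: SB.simps numeral_2_eq_2) (metis p1_linear(5) p2_linear(5) pair_p1_p2)+
  ultimately show ?thesis by (simp add: signed_iso_def star_hom_def bij_betw_def)
qed

definition triple :: "real \<Rightarrow> real \<Rightarrow> real \<Rightarrow> nat \<Rightarrow> real" where
  "triple a b c i = (if i = 0 then a else if i = 1 then b else c)"

lemma mul_comm_1:
  assumes "a \<in> S 1" "b \<in> S 1"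
  shows "mul \<gamma> 1 a b = mul \<gamma> 1 b a"
  using assms
  by (auto simp: S.simps mul.simps cj.simps rl_linear ac_simps)

lemma signed_iso_triple:
  shows "\<exists>f. signed_iso 3 (triple a b c) (triple b a c) f"
    and "\<exists>f. signed_iso 3 (triple a b c) (triple a c b) f"
    and "\<exists>f. signed_iso 3 (triple 1 b c) (triple 1 (- b) c) f"
proof -
  have *: "\<exists>f. signed_iso 3 \<gamma> \<delta> f" if "signed_iso 2 \<gamma> \<delta> f" "\<gamma> 2 = \<delta> 2" for \<gamma> \<delta> f
    using signed_iso_lift[OF that(1), of 1] that(2) by auto
  have "signed_iso 2 (triple a b c) (triple b a c)
    (\<lambda>x. pair (pair (p1 (p1 x)) (p1 (p2 x))) (pair (p2 (p1 x)) (- p2 (p2 x))))"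
    unfolding numeral_2_eq_2 by (rule signed_iso_swap) (auto simp: triple_def mul.simps mult.commute)
  then show "\<exists>f. signed_iso 3 (triple a b c) (triple b a c) f" by (rule *) (simp add: triple_def)
  have "signed_iso (Suc (Suc 1)) (triple a b c) (triple a c b)
    (\<lambda>x. pair (pair (p1 (p1 x)) (p1 (p2 x))) (pair (p2 (p1 x)) (- p2 (p2 x))))"
    by (rule signed_iso_swap) (use mul_comm_1 in \<open>auto simp: triple_def\<close>)
  then show "\<exists>f. signed_iso 3 (triple a b c) (triple a c b) f" by (auto simp: eval_nat_numeral)
  have "signed_iso 2 (triple 1 b c) (triple 1 (- b) c) (\<lambda>x. pair (p1 x) (pair (p2 (p2 x)) (p1 (p2 x))))"
    by (rule signed_iso_twist) (auto simp: triple_def)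
  then show "\<exists>f. signed_iso 3 (triple 1 b c) (triple 1 (- b) c) f" by (rule *) (simp add: triple_def)
qed

definition definite :: "(nat \<Rightarrow> real) \<Rightarrow> bool" where
  "definite \<gamma> \<longleftrightarrow> (\<forall>i<3. \<gamma> i = - 1)"

lemma less_3_iff: "i < (3 :: nat) \<longleftrightarrow> i = 0 \<or> i = 1 \<or> i = 2"
  by auto

lemma definite_iff: "definite \<gamma> \<longleftrightarrow> \<gamma> 0 = - 1 \<and> \<gamma> 1 = - 1 \<and> \<gamma> 2 = - 1"
  by (auto simp: definite_def less_3_iff)

text \<open>Swaps bring a parameter 1 to the front. A twist then turns the second parameter into 1,
  a swap moves the third into its place, and another twist finishes.\<close>

lemma signed_iso_split:
  assumes "\<And>i. i < 3 \<Longrightarrow> \<gamma> i \<in> {1, - 1}" "\<not> definite \<gamma>"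
  shows "\<exists>f. signed_iso 3 \<gamma> (triple 1 1 1) f"
proof -
  note tr = signed_iso_trans
  have one_b: "\<exists>f. signed_iso 3 (triple 1 b 1) (triple 1 1 1) f" if "b \<in> {1, - 1}" for b
    using that signed_iso_triple(3)[of "- 1" 1] signed_iso_refl[of 3 "triple 1 1 1" "triple 1 1 1"] by auto
  have one_bc: "\<exists>f. signed_iso 3 (triple 1 b c) (triple 1 1 1) f" if "b \<in> {1, - 1}" "c \<in> {1, - 1}" for b c
  proof -
    have "\<exists>f. signed_iso 3 (triple 1 b c) (triple 1 1 c) f"
      using that signed_iso_triple(3)[of "- 1" c] signed_iso_refl[of 3 "triple 1 1 c" "triple 1 1 c"] by auto
    then show ?thesis using tr signed_iso_triple(2)[of 1 1 c] one_b[OF that(2)] by meson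
  qed
  have self: "\<exists>f. signed_iso 3 \<gamma> (triple (\<gamma> 0) (\<gamma> 1) (\<gamma> 2)) f"
    by (rule exI, rule signed_iso_refl) (auto simp: triple_def less_3_iff)
  have g: "\<gamma> 0 \<in> {1, - 1}" "\<gamma> 1 \<in> {1, - 1}" "\<gamma> 2 \<in> {1, - 1}" using assms(1) by auto
  then consider "\<gamma> 0 = 1" | "\<gamma> 1 = 1" | "\<gamma> 2 = 1" using assms(2) by (auto simp: definite_iff)
  then have "\<exists>f. signed_iso 3 (triple (\<gamma> 0) (\<gamma> 1) (\<gamma> 2)) (triple 1 1 1) f"
  proof cases
    case 1
    then show ?thesis using one_bc[OF g(2,3)] by simp
  next
    case 2
    then show ?thesis using tr signed_iso_triple(1)[of "\<gamma> 0" 1 "\<gamma> 2"] one_bc[OF g(1,3)] by metis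
  next
    case 3
    then show ?thesis
      using tr signed_iso_triple(2)[of "\<gamma> 0" "\<gamma> 1" 1] signed_iso_triple(1)[of "\<gamma> 0" 1 "\<gamma> 1"] one_bc[OF g(1,2)] by metis
  qed
  then show ?thesis using self tr by meson
qed

lemma signed_iso_split_split:
  assumes "\<And>i. i < 3 \<Longrightarrow> \<gamma> i \<in> {1, - 1}" "\<not> definite \<gamma>"
    and "\<And>i. i < 3 \<Longrightarrow> \<delta> i \<in> {1, - 1}" "\<not> definite \<delta>"
  shows "\<exists>f. signed_iso 3 \<gamma> \<delta> f"
  using signed_iso_split[OF assms(1,2)] signed_iso_split[OF assms(3,4)] signed_iso_trans signed_iso_sym by meson

section \<open>Invariance of the parameters\<close>

lemma normalise:
  assumes "\<And>i. i < 3 \<Longrightarrow> \<gamma> i \<in> {1, - 1}" "\<not> definite \<gamma>"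
    and "\<And>i. i < 3 \<Longrightarrow> \<delta> i \<in> {1, - 1}" "\<not> definite \<delta>"
    and "\<And>i. 3 \<le> i \<Longrightarrow> \<delta> i = \<gamma> i"
  shows "\<exists>f. alg_iso \<gamma> \<delta> (3 + r) f"
proof -
  obtain f where "signed_iso 3 \<gamma> \<delta> f" using signed_iso_split_split[OF assms(1-4)] by blast
  then have "signed_iso (3 + r) \<gamma> \<delta> (lift r f)" by (rule signed_iso_lift) (simp add: assms(5))
  then show ?thesis using signed_iso_alg_iso by blast
qed

text \<open>If \<open>\<gamma>\<close> were not definite, its first three parameters could be
  exchanged for 1, 1, 1, against \<open>definite_not_iso\<close>.\<close>

lemma definite_of_alg_iso:
  assumes "\<And>i. i < 3 + r \<Longrightarrow> \<gamma> i \<in> {1, - 1}" "\<And>i. i < 3 + r \<Longrightarrow> \<delta> i \<in> {1, - 1}"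
    and h: "alg_iso \<gamma> \<delta> (3 + r) h" and d: "definite \<delta>"
  shows "definite \<gamma>"
proof (rule ccontr)
  assume n: "\<not> definite \<gamma>"
  define \<epsilon> where "\<epsilon> i = (if i < 3 then 1 else \<gamma> i)" for i
  obtain f where "alg_iso \<epsilon> \<gamma> (3 + r) f"
    using normalise[of \<epsilon> \<gamma> r] assms(1) n by (auto simp: \<epsilon>_def definite_iff)
  then have "alg_iso \<epsilon> \<delta> (3 + r) (\<lambda>x. h (f x))" using h by (rule alg_iso_trans)
  then show False
    by (rule definite_not_iso) (use assms(2) d in \<open>auto simp: \<epsilon>_def definite_def, fastforce\<close>)
qed

lemma alg_iso_invariants:
  assumes "\<And>i. i < 3 + r \<Longrightarrow> \<gamma> i \<in> {1, - 1}" "\<And>i. i < 3 + r \<Longrightarrow> \<delta> i \<in> {1, - 1}"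
    and "alg_iso \<gamma> \<delta> (3 + r) h"
  shows "definite \<gamma> \<longleftrightarrow> definite \<delta>" "s < r \<Longrightarrow> \<gamma> (3 + s) = \<delta> (3 + s)"
proof -
  have "(definite \<gamma> \<longleftrightarrow> definite \<delta>) \<and> (\<forall>s<r. \<gamma> (3 + s) = \<delta> (3 + s))"
    using assms
  proof (induction r arbitrary: \<gamma> \<delta> h)
    case 0
    then show ?case using definite_of_alg_iso[of 0 \<gamma> \<delta> h]
        definite_of_alg_iso[of 0 \<delta> \<gamma>, OF _ _ alg_iso_sym] by auto
  next
    case (Suc r)
    have def: "definite \<gamma> \<longleftrightarrow> definite \<delta>"
      using definite_of_alg_iso[OF Suc.prems] definite_of_alg_iso[OF Suc.prems(2,1) alg_iso_sym[OF Suc.prems(3)]]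
      by blast
    \<comment> \<open>In the split case the first three parameters are exchanged for -1, -1, 1. This
      keeps the algebra up to isomorphism and meets the requirement of
      \<open>alg_iso_delete_third\<close> that the first two be -1.\<close>
    define \<epsilon> where "\<epsilon> = (if definite \<gamma> then \<gamma> else (\<lambda>i. if i < 3 then triple (- 1) (- 1) 1 i else \<gamma> i))"
    have \<epsilon>: "\<epsilon> 0 = - 1" "\<epsilon> 1 = - 1" "\<And>i. 3 \<le> i \<Longrightarrow> \<epsilon> i = \<gamma> i"
      by (auto simp: \<epsilon>_def definite_iff triple_def)
    have "\<exists>f. alg_iso \<epsilon> \<gamma> (3 + Suc r) f"
    proof (cases "definite \<gamma>")
      case True
      then have "\<epsilon> = \<gamma>" by (simp add: \<epsilon>_def)
      then show ?thesis using signed_iso_alg_iso[OF signed_iso_refl[of "3 + Suc r" \<gamma> \<gamma>]] by auto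
    next
      case False
      then show ?thesis using Suc.prems(1)
        by (intro normalise) (auto simp: \<epsilon>_def triple_def definite_iff)
    qed
    then obtain f where f: "alg_iso \<epsilon> \<gamma> (3 + Suc r) f" by blast
    have \<epsilon>1: "\<epsilon> i \<in> {1, - 1}" if "i < 3 + Suc r" for i
      using Suc.prems(1)[OF that] by (auto simp: \<epsilon>_def triple_def)
    define \<gamma>' where "\<gamma>' = (\<lambda>s. if s < 2 then - 1 else \<epsilon> (Suc s))"
    define \<delta>' where "\<delta>' = (\<lambda>s. if s < 2 then - 1 else \<delta> (Suc s))"
    have nz: "\<epsilon> i \<noteq> 0" "\<delta> i \<noteq> 0" if "i < 3 + Suc r" for i
      using \<epsilon>1[OF that] Suc.prems(2)[OF that] by auto
    obtain \<theta> where \<theta>: "alg_iso \<delta>' \<gamma>' (2 + Suc r) \<theta>"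
      using alg_iso_delete_third[OF nz(1) \<epsilon>(1,2) nz(2) alg_iso_trans[OF f Suc.prems(3)] \<gamma>'_def \<delta>'_def] .
    \<comment> \<open>\<theta> runs from \<open>\<delta>'\<close> to \<open>\<gamma>'\<close>, so
      the induction hypothesis is used with the roles exchanged, and \<open>2 + Suc r\<close> is
      read as \<open>3 + r\<close>.\<close>
    have "(definite \<delta>' \<longleftrightarrow> definite \<gamma>') \<and> (\<forall>s<r. \<delta>' (3 + s) = \<gamma>' (3 + s))"
    proof (rule Suc.IH)
      show "alg_iso \<delta>' \<gamma>' (3 + r) \<theta>" using \<theta> by (simp add: numeral_3_eq_3)
    qed (use \<epsilon>1 Suc.prems(2) in \<open>auto simp: \<gamma>'_def \<delta>'_def\<close>)
    then have IH: "definite \<delta>' \<longleftrightarrow> definite \<gamma>'" "\<And>s. s < r \<Longrightarrow> \<delta>' (3 + s) = \<gamma>' (3 + s)" by auto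
    \<comment> \<open>The first three values of \<open>\<gamma>'\<close> are -1, -1 and
      \<open>\<gamma> 3\<close>, so \<open>\<gamma>'\<close> is definite exactly if
      \<open>\<gamma> 3\<close> is -1; likewise for \<open>\<delta>'\<close>.\<close>
    have 3: "\<gamma> 3 = \<delta> 3"
      using IH(1) Suc.prems(1)[of 3] Suc.prems(2)[of 3] \<epsilon>(3)[of 3]
      by (auto simp: \<gamma>'_def \<delta>'_def definite_iff numeral_3_eq_3)
    have "\<gamma> (3 + s) = \<delta> (3 + s)" if "s < Suc r" for s
    proof (cases s)
      case 0
      then show ?thesis using 3 by simp
    next
      case (Suc t)
      \<comment> \<open>Deletion shifts the indices: place \<open>3 + t\<close> of the shortened
        sequence is place \<open>4 + t\<close> of the original.\<close>
      then show ?thesis using IH(2)[of t] that \<epsilon>(3)[of "4 + t"]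
        by (simp add: \<gamma>'_def \<delta>'_def eval_nat_numeral)
    qed
    then show ?case using def by blast
  qed
  then show "definite \<gamma> \<longleftrightarrow> definite \<delta>" "s < r \<Longrightarrow> \<gamma> (3 + s) = \<delta> (3 + s)" by auto
qed

text \<open>The map is produced one level below \<open>h\<close>, because vertices are spanned by
  pairs of elements of level \<open>n\<close>. Equality of the last parameters lets it act on both
  components.\<close>

lemma signed_iso_of_alg_iso:
  assumes "n \<ge> 3" "\<And>i. i \<le> n \<Longrightarrow> \<gamma> i \<in> {1, - 1}" "\<And>i. i \<le> n \<Longrightarrow> \<delta> i \<in> {1, - 1}"
    and h: "alg_iso \<gamma> \<delta> (Suc n) h"
  obtains f where "signed_iso n \<gamma> \<delta> f" "\<gamma> n = \<delta> n"
proof -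
  obtain r where r: "n = 3 + r" using assms(1) le_Suc_ex by blast
  have inv: "definite \<gamma> \<longleftrightarrow> definite \<delta>" "\<And>s. s < Suc r \<Longrightarrow> \<gamma> (3 + s) = \<delta> (3 + s)"
    using alg_iso_invariants[of "Suc r" \<gamma> \<delta> h] assms r by auto
  have "\<exists>f. signed_iso 3 \<gamma> \<delta> f"
  proof (cases "definite \<gamma>")
    case True
    then show ?thesis using inv(1) signed_iso_refl[of 3 \<gamma> \<delta>] by (auto simp: definite_def)
  next
    case False
    then show ?thesis using inv(1) assms r by (intro signed_iso_split_split) auto
  qed
  then obtain f where "signed_iso 3 \<gamma> \<delta> f" by blast
  then have "signed_iso n \<gamma> \<delta> (lift r f)" unfolding r by (rule signed_iso_lift) (use inv(2) in auto)
  then show ?thesis using that inv(2)[of r] r by simp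
qed


section \<open>Trees and graphs\<close>

primrec emb :: "cd \<Rightarrow> vec" where
  "emb (CDReal r) = rl r"
| "emb (CDPair a b) = pair (emb a) (emb b)"

lemma cd_carrier_0E:
  assumes "a \<in> cd_carrier 0" obtains r where "a = CDReal r"
  using assms by auto

lemma cd_carrier_SucE:
  assumes "a \<in> cd_carrier (Suc k)"
  obtains b c where "a = CDPair b c" "b \<in> cd_carrier k" "c \<in> cd_carrier k"
  using assms by auto

lemma bij_emb: "bij_betw emb (cd_carrier k) (S k)"
proof (induction k)
  case 0
  then show ?case by (auto simp: bij_betw_def inj_on_def S.simps image_image)
next
  case (Suc k)
  then have inj: "inj_on emb (cd_carrier k)" and im: "emb ` cd_carrier k = S k"
    by (auto simp: bij_betw_def)
  have "inj_on emb (cd_carrier (Suc k))"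
    using inj by (auto simp: inj_on_def)
  moreover have "emb ` cd_carrier (Suc k) = S (Suc k)"
  proof
    show "emb ` cd_carrier (Suc k) \<subseteq> S (Suc k)" by (auto simp flip: im)
    show "S (Suc k) \<subseteq> emb ` cd_carrier (Suc k)"
    proof
      fix x assume "x \<in> S (Suc k)"
      then obtain a b where x: "x = pair a b" "a \<in> S k" "b \<in> S k" by (elim S_SucE)
      then obtain c d where "c \<in> cd_carrier k" "d \<in> cd_carrier k" "a = emb c" "b = emb d"
        using im by blast
      then show "x \<in> emb ` cd_carrier (Suc k)" using x by (intro image_eqI[of _ _ "CDPair c d"]) auto
    qed
  qed
  ultimately show ?case by (simp add: bij_betw_def)
qed

lemma emb_in_S [simp, intro]: "a \<in> cd_carrier k \<Longrightarrow> emb a \<in> S k"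
  using bij_emb by (auto simp: bij_betw_def)

lemma emb_eq_iff: "a \<in> cd_carrier k \<Longrightarrow> b \<in> cd_carrier k \<Longrightarrow> emb a = emb b \<longleftrightarrow> a = b"
  using bij_emb[of k] by (auto simp: bij_betw_def inj_on_def)

lemma emb_cd_zero [simp]: "cd_zero k \<in> cd_carrier k" "emb (cd_zero k) = 0"
  by (induction k) auto

lemma emb_cd_scale [simp]:
  shows "a \<in> cd_carrier k \<Longrightarrow> cd_scale r a \<in> cd_carrier k"
    and "emb (cd_scale r a) = r *\<^sub>R emb a"
proof -
  show "a \<in> cd_carrier k \<Longrightarrow> cd_scale r a \<in> cd_carrier k"
    by (induction k arbitrary: a) auto
  show "emb (cd_scale r a) = r *\<^sub>R emb a"
    by (induction a) (auto simp: rl_linear pair_scaleR)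
qed

lemma emb_cd_add [simp]:
  assumes "a \<in> cd_carrier k" "b \<in> cd_carrier k"
  shows "cd_add a b \<in> cd_carrier k" "emb (cd_add a b) = emb a + emb b"
proof -
  have "cd_add a b \<in> cd_carrier k \<and> emb (cd_add a b) = emb a + emb b"
    using assms by (induction k arbitrary: a b) (auto simp: rl_linear pair_add)
  then show "cd_add a b \<in> cd_carrier k" "emb (cd_add a b) = emb a + emb b" by auto
qed

lemma emb_cd_conj [simp]:
  assumes "a \<in> cd_carrier k"
  shows "cd_conj a \<in> cd_carrier k" "emb (cd_conj a) = cj k (emb a)"
proof -
  have "cd_conj a \<in> cd_carrier k \<and> emb (cd_conj a) = cj k (emb a)"
    using assms
  proof (induction k arbitrary: a)
    case 0
    then show ?case by (elim cd_carrier_0E) simp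
  next
    case (Suc k)
    from Suc.prems show ?case by (rule cd_carrier_SucE) (simp add: Suc.IH emb_cd_scale(1)[of _ k])
  qed
  then show "cd_conj a \<in> cd_carrier k" "emb (cd_conj a) = cj k (emb a)" by auto
qed

lemma emb_cd_mult [simp]:
  assumes "a \<in> cd_carrier k" "b \<in> cd_carrier k"
  shows "cd_mult \<gamma> k a b \<in> cd_carrier k" "emb (cd_mult \<gamma> k a b) = mul \<gamma> k (emb a) (emb b)"
proof -
  have "cd_mult \<gamma> k a b \<in> cd_carrier k \<and> emb (cd_mult \<gamma> k a b) = mul \<gamma> k (emb a) (emb b)"
    using assms
  proof (induction k arbitrary: a b)
    case 0
    then show ?case by (auto simp: mul.simps)
  next
    case (Suc k)
    obtain c d where a: "a = CDPair c d" "c \<in> cd_carrier k" "d \<in> cd_carrier k"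
      using Suc.prems(1) by (elim cd_carrier_SucE)
    obtain e f where b: "b = CDPair e f" "e \<in> cd_carrier k" "f \<in> cd_carrier k"
      using Suc.prems(2) by (elim cd_carrier_SucE)
    have m: "cd_mult \<gamma> k u v \<in> cd_carrier k" "emb (cd_mult \<gamma> k u v) = mul \<gamma> k (emb u) (emb v)"
      if "u \<in> cd_carrier k" "v \<in> cd_carrier k" for u v using Suc.IH that by auto
    have c: "cd_conj u \<in> cd_carrier k" "emb (cd_conj u) = cj k (emb u)" if "u \<in> cd_carrier k" for u
      using that by auto
    show ?case unfolding a(1) b(1) using a b
      by (simp add: m c emb_cd_add[of _ k] emb_cd_scale(1)[of _ k])
  qed
  then show "cd_mult \<gamma> k a b \<in> cd_carrier k" "emb (cd_mult \<gamma> k a b) = mul \<gamma> k (emb a) (emb b)" by auto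
qed

lemma cd_basis_in_carrier [simp]: "cd_basis k j \<in> cd_carrier k"
  by (induction k arbitrary: j) auto

lemma emb_cd_basis_0 [simp]: "emb (cd_basis k 0) = e0"
  by (induction k) (auto simp: pair_rl_0)

lemma std_basis_0: "std_basis 0 = {CDReal 1}"
  by (auto simp: std_basis_def)

lemma std_basis_Suc: "std_basis (Suc k) =
    (\<lambda>a. CDPair a (cd_zero k)) ` std_basis k \<union> CDPair (cd_zero k) ` std_basis k"
proof -
  have "{..<2 ^ Suc k} = {..<2 ^ k} \<union> (\<lambda>j. j + 2 ^ k) ` {..<(2 :: nat) ^ k}"
  proof (intro equalityI subsetI)
    fix j :: nat assume "j \<in> {..<2 ^ Suc k}"
    then show "j \<in> {..<2 ^ k} \<union> (\<lambda>j. j + 2 ^ k) ` {..<2 ^ k}"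
      by (cases "j < 2 ^ k") (auto intro!: image_eqI[of _ _ "j - 2 ^ k"])
  qed auto
  moreover have "cd_basis (Suc k) ` {..<2 ^ k} = (\<lambda>a. CDPair a (cd_zero k)) ` std_basis k"
    unfolding std_basis_def image_image by (rule image_cong) simp_all
  moreover have "cd_basis (Suc k) ` (\<lambda>j. j + 2 ^ k) ` {..<2 ^ k} = CDPair (cd_zero k) ` std_basis k"
    unfolding std_basis_def image_image by (rule image_cong) simp_all
  ultimately show ?thesis unfolding std_basis_def[of "Suc k"] by (simp only: image_Un)
qed

lemma std_basis_carrier: "std_basis k \<subseteq> cd_carrier k"
  by (auto simp: std_basis_def)

lemma signed_basis_carrier: "signed_basis k \<subseteq> cd_carrier k"
  and imag_basis_carrier: "imag_basis k \<subseteq> cd_carrier k"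
  using std_basis_carrier[of k]
  by (auto simp: signed_basis_def imag_basis_def intro!: emb_cd_scale(1))

lemma signed_basis_iff:
  assumes "a \<in> cd_carrier k"
  shows "a \<in> signed_basis k \<longleftrightarrow> emb a \<in> SB k"
proof -
  have std: "emb ` std_basis k \<union> uminus ` emb ` std_basis k = SB k"
  proof (induction k)
    case 0
    then show ?case by (simp add: std_basis_0 SB.simps insert_commute)
  next
    case (Suc k)
    have p_pair: "x = pair (p1 x) 0" if "p2 x = 0" for x using that pair_p1_p2[of x] by simp
    have p_pair': "x = pair 0 (p2 x)" if "p1 x = 0" for x using that pair_p1_p2[of x] by simp
    have "SB (Suc k) = (\<lambda>a. pair a 0) ` SB k \<union> pair 0 ` SB k"
    proof (intro equalityI subsetI)
      fix x assume "x \<in> SB (Suc k)"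
      then show "x \<in> (\<lambda>a. pair a 0) ` SB k \<union> pair 0 ` SB k"
        unfolding SB.simps(2)
        using p_pair[of x] p_pair'[of x] by blast
    qed auto
    then show ?case unfolding Suc[symmetric] std_basis_Suc
      by (auto simp: image_Un image_image pair_minus)
  qed
  have sub: "signed_basis k \<subseteq> cd_carrier k"
    by (rule signed_basis_carrier)
  have "emb ` signed_basis k = SB k"
    unfolding std[symmetric] signed_basis_def by (simp add: image_Un image_image)
  then show ?thesis using sub emb_eq_iff[OF assms] by blast
qed

section \<open>From algebra isomorphisms to maps between graphs\<close>

lemma CD_simps [simp]:
  "carrier (CD \<gamma> k) = cd_carrier k" "mult (CD \<gamma> k) = cd_mult \<gamma> k" "\<one>\<^bsub>CD \<gamma> k\<^esub> = cd_basis k 0"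
  "zero (CD \<gamma> k) = cd_zero k" "add (CD \<gamma> k) = cd_add" "smult (CD \<gamma> k) = cd_scale"
  by (simp_all add: CD_def)

definition unemb :: "nat \<Rightarrow> vec \<Rightarrow> cd" where
  "unemb k = inv_into (cd_carrier k) emb"

lemma unemb [simp]:
  "x \<in> S k \<Longrightarrow> unemb k x \<in> cd_carrier k" "x \<in> S k \<Longrightarrow> emb (unemb k x) = x"
  "a \<in> cd_carrier k \<Longrightarrow> unemb k (emb a) = a"
  using bij_emb[of k] unfolding unemb_def bij_betw_def
  by (auto simp: inv_into_into f_inv_into_f)

lemma unemb_eqI: "a \<in> cd_carrier k \<Longrightarrow> emb a = x \<Longrightarrow> unemb k x = a"
  by auto

lemma alg_iso_of_isomorphic:
  assumes "algebras_isomorphic (CD \<gamma> k) (CD \<delta> k)"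
  obtains h where "alg_iso \<gamma> \<delta> k h"
proof -
  obtain h where h: "h \<in> ring_iso (CD \<gamma> k) (CD \<delta> k)"
      "\<And>r x. x \<in> cd_carrier k \<Longrightarrow> h (cd_scale r x) = cd_scale r (h x)"
    using assms by (auto simp: algebras_isomorphic_def algebra_iso_def)
  then have bij: "bij_betw h (cd_carrier k) (cd_carrier k)"
    and mult: "\<And>x y. x \<in> cd_carrier k \<Longrightarrow> y \<in> cd_carrier k \<Longrightarrow> h (cd_mult \<gamma> k x y) = cd_mult \<delta> k (h x) (h y)"
    and add: "\<And>x y. x \<in> cd_carrier k \<Longrightarrow> y \<in> cd_carrier k \<Longrightarrow> h (cd_add x y) = cd_add (h x) (h y)"
    by (auto simp: ring_iso_def ring_hom_def)
  have hc: "h x \<in> cd_carrier k" if "x \<in> cd_carrier k" for x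
    using that bij by (auto simp: bij_betw_def)
  let ?g = "\<lambda>x. emb (h (unemb k x))"
  have "bij_betw (unemb k) (S k) (cd_carrier k)"
    unfolding unemb_def by (rule bij_betw_inv_into[OF bij_emb])
  from bij_betw_trans[OF bij_betw_trans[OF this bij] bij_emb]
  have "bij_betw ?g (S k) (S k)" by (simp add: comp_def)
  moreover have "unemb k (x + y) = cd_add (unemb k x) (unemb k y)"
      "unemb k (mul \<gamma> k x y) = cd_mult \<gamma> k (unemb k x) (unemb k y)"
      "unemb k (r *\<^sub>R x) = cd_scale r (unemb k x)"
    if "x \<in> S k" "y \<in> S k" for x y r using that by (auto intro!: unemb_eqI simp: emb_cd_add[of _ k])
  ultimately have "alg_iso \<gamma> \<delta> k ?g"
    unfolding alg_iso_def lin_def by (auto simp: hc add mult h(2) emb_cd_add[of _ k])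
  then show ?thesis using that by blast
qed

text \<open>Collects the properties of a map of algebras that make its image map act on vertices and
  adjacency. A sign is allowed in the last clause, since negation does not change a line.\<close>

definition Gamma_iso :: "(nat \<Rightarrow> real) \<Rightarrow> (nat \<Rightarrow> real) \<Rightarrow> nat \<Rightarrow> (cd \<Rightarrow> cd) \<Rightarrow> bool" where
  "Gamma_iso \<gamma> \<delta> n G \<longleftrightarrow> bij_betw G (cd_carrier (Suc n)) (cd_carrier (Suc n)) \<and>
     G (cd_zero (Suc n)) = cd_zero (Suc n) \<and>
     (\<forall>r. \<forall>u\<in>cd_carrier (Suc n). G (cd_scale r u) = cd_scale r (G u)) \<and>
     (\<forall>u\<in>cd_carrier (Suc n). \<forall>v\<in>cd_carrier (Suc n).
        G (cd_mult \<gamma> (Suc n) u v) = cd_mult \<delta> (Suc n) (G u) (G v)) \<and>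
     (\<forall>a\<in>imag_basis n. \<forall>b\<in>signed_basis n. \<exists>a'\<in>imag_basis n. \<exists>b'\<in>signed_basis n.
        G (CDPair a b) = CDPair a' b' \<or> G (CDPair a b) = cd_neg (CDPair a' b'))"

lemma line_CD: "line (CD \<gamma> k) u = range (\<lambda>r. cd_scale r u)"
  by (simp add: line_def)

lemma cd_scale_scale: "cd_scale r (cd_scale s u) = cd_scale (r * s) u"
  by (induction u) auto

lemma line_neg: "line (CD \<gamma> k) (cd_neg u) = line (CD \<gamma> k) u"
proof -
  have "cd_scale r u = cd_scale (- r) (cd_neg u)" for r by (simp add: cd_scale_scale)
  then have "range (\<lambda>r. cd_scale r u) \<subseteq> range (\<lambda>r. cd_scale r (cd_neg u))" by blast
  then show ?thesis by (auto simp: line_CD cd_scale_scale)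
qed

lemma zero_divisor_neg:
  assumes "u \<in> cd_carrier k" "zero_divisor (CD \<gamma> k) (cd_neg u)"
  shows "zero_divisor (CD \<gamma> k) u"
proof -
  have z: "cd_scale (- 1) (cd_zero k) = cd_zero k" by (induction k) auto
  have m: "emb (cd_mult \<gamma> k (cd_neg u) v) = - emb (cd_mult \<gamma> k u v)"
      "emb (cd_mult \<gamma> k v (cd_neg u)) = - emb (cd_mult \<gamma> k v u)" if "v \<in> cd_carrier k" for v
    using that assms(1) by simp_all
  have e: "cd_mult \<gamma> k u v = cd_zero k \<longleftrightarrow> emb (cd_mult \<gamma> k u v) = 0" if "u \<in> cd_carrier k" "v \<in> cd_carrier k" for u v
    using emb_eq_iff[of "cd_mult \<gamma> k u v" k "cd_zero k"] that by simp
  show ?thesis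
    using assms z m e[OF assms(1)] e[OF emb_cd_scale(1)[OF assms(1)]] e[OF _ assms(1)] e[OF _ emb_cd_scale(1)[OF assms(1)]]
    by (simp add: zero_divisor_def) (metis z neg_equal_0_iff_equal)
qed

lemma adj_Gamma_e: "adj (Gamma_e \<gamma> n) L M \<longleftrightarrow>
    L \<in> verts (Gamma_e \<gamma> n) \<and> M \<in> verts (Gamma_e \<gamma> n) \<and> L \<noteq> M \<and>
    (\<exists>u\<in>cd_carrier (Suc n). \<exists>v\<in>cd_carrier (Suc n). L = line (CD \<gamma> (Suc n)) u \<and>
       M = line (CD \<gamma> (Suc n)) v \<and> orthogonal_in (CD \<gamma> (Suc n)) u v)"
  by (simp add: Gamma_e_def Let_def del: cd_carrier.simps)

context
  fixes \<gamma> \<delta> n G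
  assumes G: "Gamma_iso \<gamma> \<delta> n G"
begin

lemma Gamma_isoD:
  "bij_betw G (cd_carrier (Suc n)) (cd_carrier (Suc n))"
  "G (cd_zero (Suc n)) = cd_zero (Suc n)"
  "u \<in> cd_carrier (Suc n) \<Longrightarrow> G u \<in> cd_carrier (Suc n)"
  "u \<in> cd_carrier (Suc n) \<Longrightarrow> G (cd_scale r u) = cd_scale r (G u)"
  "u \<in> cd_carrier (Suc n) \<Longrightarrow> v \<in> cd_carrier (Suc n) \<Longrightarrow>
     G (cd_mult \<gamma> (Suc n) u v) = cd_mult \<delta> (Suc n) (G u) (G v)"
proof -
  show bij: "bij_betw G (cd_carrier (Suc n)) (cd_carrier (Suc n))"
    and "G (cd_zero (Suc n)) = cd_zero (Suc n)"
    and "u \<in> cd_carrier (Suc n) \<Longrightarrow> G (cd_scale r u) = cd_scale r (G u)"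
    and "u \<in> cd_carrier (Suc n) \<Longrightarrow> v \<in> cd_carrier (Suc n) \<Longrightarrow>
      G (cd_mult \<gamma> (Suc n) u v) = cd_mult \<delta> (Suc n) (G u) (G v)"
    using G unfolding Gamma_iso_def by blast+
  show "u \<in> cd_carrier (Suc n) \<Longrightarrow> G u \<in> cd_carrier (Suc n)"
    using bij_betw_apply[OF bij] .
qed

lemma Gamma_iso_line:
  assumes "u \<in> cd_carrier (Suc n)"
  shows "G ` line (CD \<gamma> (Suc n)) u = line (CD \<delta> (Suc n)) (G u)"
  using assms by (simp add: line_CD image_image Gamma_isoD)

lemma Gamma_iso_zero_divisor:
  assumes "zero_divisor (CD \<gamma> (Suc n)) u"
  shows "zero_divisor (CD \<delta> (Suc n)) (G u)"
proof -
  let ?z = "cd_zero (Suc n)"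
  obtain v where u: "u \<in> cd_carrier (Suc n)" "u \<noteq> ?z" and v: "v \<in> cd_carrier (Suc n)" "v \<noteq> ?z"
    and uv: "cd_mult \<gamma> (Suc n) u v = ?z \<or> cd_mult \<gamma> (Suc n) v u = ?z"
    using assms unfolding zero_divisor_def CD_simps by blast
  have nz: "G w \<noteq> ?z" if "w \<in> cd_carrier (Suc n)" "w \<noteq> ?z" for w
    using that Gamma_isoD(1,2) emb_cd_zero(1)[of "Suc n"] unfolding bij_betw_def by (metis inj_onD)
  have "cd_mult \<delta> (Suc n) (G u) (G v) = ?z \<or> cd_mult \<delta> (Suc n) (G v) (G u) = ?z"
    using uv Gamma_isoD(2) Gamma_isoD(5)[OF u(1) v(1)] Gamma_isoD(5)[OF v(1) u(1)] by metis
  then show ?thesis unfolding zero_divisor_def CD_simps using nz[OF u] nz[OF v] Gamma_isoD(3)[OF u(1)] Gamma_isoD(3)[OF v(1)] by blast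
qed

lemma Gamma_iso_vert:
  assumes "L \<in> verts (Gamma_e \<gamma> n)"
  shows "G ` L \<in> verts (Gamma_e \<delta> n)"
proof -
  obtain a b where ab: "L = line (CD \<gamma> (Suc n)) (CDPair a b)" "a \<in> imag_basis n" "b \<in> signed_basis n"
      "zero_divisor (CD \<gamma> (Suc n)) (CDPair a b)"
    using assms by (auto simp: Gamma_e_def Let_def)
  have c: "CDPair a b \<in> cd_carrier (Suc n)" using ab(4) by (simp add: zero_divisor_def)
  obtain a' b' where ab': "a' \<in> imag_basis n" "b' \<in> signed_basis n"
      "G (CDPair a b) = CDPair a' b' \<or> G (CDPair a b) = cd_neg (CDPair a' b')"
    using G ab(2,3) unfolding Gamma_iso_def by blast
  have c': "CDPair a' b' \<in> cd_carrier (Suc n)"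
    using ab'(1,2) signed_basis_carrier imag_basis_carrier by auto
  have "line (CD \<delta> (Suc n)) (G (CDPair a b)) = line (CD \<delta> (Suc n)) (CDPair a' b')"
    using ab'(3) line_neg by metis
  then have "G ` L = line (CD \<delta> (Suc n)) (CDPair a' b')"
    by (simp only: ab(1) Gamma_iso_line[OF c])
  moreover have "zero_divisor (CD \<delta> (Suc n)) (CDPair a' b')"
    using ab'(3) Gamma_iso_zero_divisor[OF ab(4)] zero_divisor_neg[OF c'] by auto
  ultimately show ?thesis using ab' by (auto simp: Gamma_e_def Let_def)
qed

lemma vert_subset_carrier: "L \<in> verts (Gamma_e \<gamma> n) \<Longrightarrow> L \<subseteq> cd_carrier (Suc n)"
  by (auto simp: Gamma_e_def Let_def zero_divisor_def line_def)

lemma Gamma_iso_adj: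
  assumes "adj (Gamma_e \<gamma> n) L M"
  shows "adj (Gamma_e \<delta> n) (G ` L) (G ` M)"
proof -
  have LM: "L \<in> verts (Gamma_e \<gamma> n)" "M \<in> verts (Gamma_e \<gamma> n)" "L \<noteq> M"
    using assms unfolding adj_Gamma_e by blast+
  obtain u v where uv: "u \<in> cd_carrier (Suc n)" "v \<in> cd_carrier (Suc n)"
      "L = line (CD \<gamma> (Suc n)) u" "M = line (CD \<gamma> (Suc n)) v" "orthogonal_in (CD \<gamma> (Suc n)) u v"
    using assms unfolding adj_Gamma_e by blast
  have "G ` L \<noteq> G ` M"
    using LM vert_subset_carrier Gamma_isoD(1) inj_on_image_eq_iff unfolding bij_betw_def by metis
  moreover have "orthogonal_in (CD \<delta> (Suc n)) (G u) (G v)"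
    using uv(5) Gamma_isoD(2) Gamma_isoD(5)[OF uv(1,2)] Gamma_isoD(5)[OF uv(2,1)]
    by (simp add: orthogonal_in_def)
  ultimately show ?thesis
    using Gamma_iso_vert[OF LM(1)] Gamma_iso_vert[OF LM(2)] Gamma_iso_line[OF uv(1)] Gamma_iso_line[OF uv(2)]
      Gamma_isoD(3)[OF uv(1)] Gamma_isoD(3)[OF uv(2)]
    unfolding adj_Gamma_e uv(3,4) by blast
qed

end

text \<open>\<open>Gamma_iso_adj\<close> preserves adjacency in one direction only; the inverse map
  supplies the converse.\<close>

lemma graphs_isomorphic_of_Gamma_iso:
  assumes G: "Gamma_iso \<gamma> \<delta> n G" and H: "Gamma_iso \<delta> \<gamma> n H"
    and HG: "\<And>u. u \<in> cd_carrier (Suc n) \<Longrightarrow> H (G u) = u" and GH: "\<And>u. u \<in> cd_carrier (Suc n) \<Longrightarrow> G (H u) = u"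
  shows "graphs_isomorphic (Gamma_e \<gamma> n) (Gamma_e \<delta> n)"
proof -
  have HGL: "H ` G ` L = L" if "L \<in> verts (Gamma_e \<gamma> n)" for L
    using vert_subset_carrier[OF G that] HG by (force simp: image_image)
  have GHL: "G ` H ` L = L" if "L \<in> verts (Gamma_e \<delta> n)" for L
    using vert_subset_carrier[OF H that] GH by (force simp: image_image)
  have "bij_betw (image G) (verts (Gamma_e \<gamma> n)) (verts (Gamma_e \<delta> n))"
    by (rule bij_betw_byWitness[of _ "image H"])
      (use HGL GHL Gamma_iso_vert[OF G] Gamma_iso_vert[OF H] in auto)
  moreover have "adj (Gamma_e \<gamma> n) L M \<longleftrightarrow> adj (Gamma_e \<delta> n) (G ` L) (G ` M)"
    if "L \<in> verts (Gamma_e \<gamma> n)" "M \<in> verts (Gamma_e \<gamma> n)" for L M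
    using Gamma_iso_adj[OF G, of L M] Gamma_iso_adj[OF H, of "G ` L" "G ` M"] HGL that by auto
  ultimately show ?thesis unfolding graphs_isomorphic_def by blast
qed

lemma Gamma_iso_of_signed_iso:
  assumes f: "signed_iso n \<gamma> \<delta> f" and n: "\<gamma> n = \<delta> n"
  shows "Gamma_iso \<gamma> \<delta> n (\<lambda>u. unemb (Suc n) (lift 1 f (emb u)))"
proof -
  let ?F = "lift 1 f" and ?C = "cd_carrier (Suc n)"
  let ?G = "\<lambda>u. unemb (Suc n) (?F (emb u))"
  have F: "signed_iso (Suc n) \<gamma> \<delta> ?F" using signed_iso_lift[OF f, of 1] n by simp
  note L = linD[OF star_homD(1)[OF signed_isoD(1)[OF F]]] and Lf = linD[OF star_homD(1)[OF signed_isoD(1)[OF f]]]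
  have "bij_betw (unemb (Suc n)) (S (Suc n)) ?C"
    unfolding unemb_def by (rule bij_betw_inv_into[OF bij_emb])
  from bij_betw_trans[OF bij_betw_trans[OF bij_emb signed_isoD(2)[OF F]] this]
  have "bij_betw ?G ?C ?C" by (simp add: comp_def)
  moreover have "?G (cd_zero (Suc n)) = cd_zero (Suc n)"
    using L(5) emb_cd_zero[of "Suc n"] by (intro unemb_eqI) (auto simp del: cd_zero.simps)
  moreover have "?G (cd_scale r u) = cd_scale r (?G u)" if "u \<in> ?C" for r u
    using that L(1,3) emb_in_S[OF that] by (intro unemb_eqI) (simp_all del: lift.simps cd_carrier.simps One_nat_def)
  moreover have "?G (cd_mult \<gamma> (Suc n) u v) = cd_mult \<delta> (Suc n) (?G u) (?G v)" if "u \<in> ?C" "v \<in> ?C" for u v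
    using that L(1) emb_in_S[OF that(1)] emb_in_S[OF that(2)] star_homD(4)[OF signed_isoD(1)[OF F]]
    by (intro unemb_eqI) (simp_all del: lift.simps cd_carrier.simps One_nat_def)
  moreover have "\<exists>a'\<in>imag_basis n. \<exists>b'\<in>signed_basis n.
        ?G (CDPair a b) = CDPair a' b' \<or> ?G (CDPair a b) = cd_neg (CDPair a' b')"
    if ab: "a \<in> imag_basis n" "b \<in> signed_basis n" for a b
  proof -
    have c: "a \<in> cd_carrier n" "b \<in> cd_carrier n"
      using ab signed_basis_carrier imag_basis_carrier by auto
    have as: "a \<in> signed_basis n" using ab by (simp add: imag_basis_def signed_basis_def)
    define x where "x = unemb n (f (emb a))"
    define y where "y = unemb n (f (emb b))"
    have xy: "x \<in> cd_carrier n" "y \<in> cd_carrier n" "emb x = f (emb a)" "emb y = f (emb b)"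
      using c Lf by (auto simp: x_def y_def)
    have sb: "x \<in> signed_basis n" "y \<in> signed_basis n"
      using signed_basis_iff signed_isoD(3)[OF f] xy c as ab by auto
    have G: "?G (CDPair a b) = CDPair x y" using xy by (intro unemb_eqI) auto
    have inj: "inj_on f (S n)" using signed_isoD(2)[OF f] by (simp add: bij_betw_def)
    have ne: "emb a \<noteq> e0"
      using ab(1) emb_eq_iff[OF c(1) cd_basis_in_carrier[of n 0]] by (auto simp: imag_basis_def)
    \<comment> \<open>All coefficients at 0 of standard basis elements are nonnegative, which
      excludes the negative of the unit.\<close>
    have ne': "emb a \<noteq> - e0"
    proof
      assume "emb a = - e0"
      moreover obtain j where "a = cd_basis n j" using ab(1) by (auto simp: imag_basis_def std_basis_def)
      moreover have "cf (emb (cd_basis n j)) 0 \<ge> 0" for j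
        by (induction n arbitrary: j) (auto simp: pair_def)
      ultimately show False by (metis cf_linear(4) neg_0_le_iff_le not_one_le_zero rl_at_0)
    qed
    have f1: "f e0 = e0" "f (- e0) = - e0"
      using star_homD(2)[OF signed_isoD(1)[OF f]] Lf(4)[of e0] by auto
    \<comment> \<open>\<open>f\<close> is injective and fixes the unit and its negative, so the
      image of an imaginary basis element is neither.\<close>
    have nx: "emb x \<noteq> e0" "emb x \<noteq> - e0"
      unfolding xy(3) using ne ne' f1 inj_onD[OF inj _ emb_in_S[OF c(1)], of e0]
        inj_onD[OF inj _ emb_in_S[OF c(1)], of "- e0"] by (metis rl_in_S S_closed(3))+
    from sb(1) consider "x \<in> std_basis n" | z where "z \<in> std_basis n" "x = cd_neg z"
      by (auto simp: signed_basis_def)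
    then show ?thesis
    proof cases
      case 1
      then have "x \<in> imag_basis n" using nx by (auto simp: imag_basis_def)
      then show ?thesis using sb G by blast
    next
      case 2
      then have "z \<in> imag_basis n" using nx by (auto simp: imag_basis_def)
      \<comment> \<open>If \<open>f\<close> sends \<open>a\<close> to the negative of a basis
        element, the sign is taken out of the whole pair, which changes the sign of the second
        component.\<close>
      moreover have "cd_neg y \<in> signed_basis n"
        using sb(2) signed_basis_iff[OF xy(2)] signed_basis_iff[OF emb_cd_scale(1)[OF xy(2)]] by simp
      moreover have "cd_scale 1 w = w" for w by (induction w) auto
      then have "CDPair x y = cd_neg (CDPair z (cd_neg y))" using 2 by (simp add: cd_scale_scale)
      ultimately show ?thesis using G by metis
    qed
  qed
  ultimately show ?thesis unfolding Gamma_iso_def by blast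
qed

theorem theorem5p17:
  fixes n :: nat and \<gamma> lam :: "nat \<Rightarrow> real"
  assumes "n \<ge> 3"
    and "\<forall>i\<le>n. \<gamma> i \<in> {1, -1}"
    and "\<forall>i\<le>n. lam i \<in> {1, -1}"
    and "algebras_isomorphic (CD \<gamma> (n + 1)) (CD lam (n + 1))"
  shows "graphs_isomorphic (Gamma_e \<gamma> n) (Gamma_e lam n)"
proof -
  obtain h where "alg_iso \<gamma> lam (Suc n) h"
    using alg_iso_of_isomorphic[of \<gamma> "Suc n" lam] assms(4) by auto
  then obtain f where f: "signed_iso n \<gamma> lam f" "\<gamma> n = lam n"
    using signed_iso_of_alg_iso[of n \<gamma> lam h] assms(1-3) by blast
  \<comment> \<open>The inverse is lifted by one doubling in the same way as \<open>f\<close> and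
    gives the inverse map of graphs.\<close>
  let ?g = "inv_into (S n) f"
  note g = signed_iso_sym[OF f(1)]
  have gf: "?g (f x) = x" "f (?g x) = x" if "x \<in> S n" for x
    using signed_isoD(2)[OF f(1)] that by (auto simp: bij_betw_def f_inv_into_f)
  have inv: "lift 1 ?g (lift 1 f x) = x" "lift 1 f (lift 1 ?g x) = x" if "x \<in> S (Suc n)" for x
    using that gf by (auto elim!: S_SucE)
  have S: "lift 1 f x \<in> S (Suc n)" "lift 1 ?g x \<in> S (Suc n)" if "x \<in> S (Suc n)" for x
    using linD(1)[OF lift_lin[OF star_homD(1)[OF signed_isoD(1)[OF f(1)]], where r = 1], of x]
      linD(1)[OF lift_lin[OF star_homD(1)[OF signed_isoD(1)[OF g]], where r = 1], of x] that
    by (simp_all del: lift.simps)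
  show ?thesis
  proof (rule graphs_isomorphic_of_Gamma_iso[OF Gamma_iso_of_signed_iso[OF f] Gamma_iso_of_signed_iso[OF g f(2)[symmetric]]])
    fix u assume u: "u \<in> cd_carrier (Suc n)"
    show "unemb (Suc n) (lift 1 ?g (emb (unemb (Suc n) (lift 1 f (emb u))))) = u"
      "unemb (Suc n) (lift 1 f (emb (unemb (Suc n) (lift 1 ?g (emb u))))) = u"
      using unemb(2)[OF S(1)[OF emb_in_S[OF u]]] unemb(2)[OF S(2)[OF emb_in_S[OF u]]]
        inv[OF emb_in_S[OF u]] unemb(3)[OF u] by metis+
  qed
qed

end
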